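(* Let $t,s,s_1,s_2\in\mathbb{N}$, $m\in\mathbb{Z}$, $\alpha\in\mathrm{Ext}_{2t+1}(V)$, $\omega\in\mathrm{Ext}^{2t+1}(V)$, $\beta\in\mathrm{Ext}_{2s}(V)$, $\beta_i\in\mathrm{Ext}_{2s_i}(V)$, $\mu\in\mathrm{Ext}^{2s}(V)$, $\mu_i\in\mathrm{Ext}^{2s_i}(V)$ ($i=1,2$). For any filtrations of hypergraphs $\{\mathcal{H}_x\}_{x\in\mathbb{R}}$ and $\{\mathcal{H}'_x\}_{x\in\mathbb{R}}$ with their vertices from $V$: (1) There is an induced morphism $$\beta_*:\ \mathbf{PMV}_*(\mathcal{H}_x,\mathcal{H}'_x,\alpha,m\mid x\in\mathbb{R})\to\mathbf{PMV}_*(\mathcal{H}_x,\mathcal{H}'_x,\alpha,m-2s\mid x\in\mathbb{R}).$$ Moreover, $(\beta_1\wedge\beta_2)_*=(\beta_1)_*(\beta_2)_*=(\beta_2)_*(\beta_1)_*$ as morphisms $\mathbf{PMV}_*(\mathcal{H}_x,\mathcal{H}'_x,\alpha,m\mid x\in\mathbb{R})\to\mathbf{PMV}_*(\mathcal{H}_x,\mathcal{H}'_x,\alpha,m-2s_1-2s_2\mid x\in\mathbb{R})$; that is, the square with the sides $(\beta_1)_*,(\beta_2)_*$ and the diagonal $(\beta_1\wedge\beta_2)_*$ commutes. (2) There is an induced morphism $$\mu_*:\ \mathbf{PMV}^*(\mathcal{H}_x,\mathcal{H}'_x,\omega,m\mid x\in\mathbb{R})\to\mathbf{PMV}^*(\mathcal{H}_x,\mathcal{H}'_x,\omega,m+2s\mid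 x\in\mathbb{R}).$$ Moreover, $(\mu_1\wedge\mu_2)_*=(\mu_1)_*(\mu_2)_*=(\mu_2)_*(\mu_1)_*$ as morphisms $\mathbf{PMV}^*(\mathcal{H}_x,\mathcal{H}'_x,\omega,m\mid x\in\mathbb{R})\to\mathbf{PMV}^*(\mathcal{H}_x,\mathcal{H}'_x,\omega,m+2s_1+2s_2\mid x\in\mathbb{R})$; that is, the square with the sides $(\mu_1)_*,(\mu_2)_*$ and the diagonal $(\mu_1\wedge\mu_2)_*$ commutes.
   Context: $R$ is a commutative ring without zero divisors, with unit $1$, in which $2$ is invertible. ($\mathbb{R}$ is the set of real numbers.) $V$ is a discrete set (of vertices) with a total order $\prec$. Hypergraphs. $\Delta[V]$ is the collection of all non-empty finite subsets of $V$; a hypergraph with vertices from $V$ is any $\mathcal{H}\subseteq\Delta[V]$. It is a simplicial complex if it contains every non-empty subset of each of its elements, and an independence hypergraph if it contains every finite superset (in $V$) of each of its elements. For a hypergraph $\mathcal{H}$: $\Delta\mathcal{H}=\{\tau\in\Delta[V]\mid\tau\subseteq\sigma\text{ for some }\sigma\in\mathcal{H}\}$ and $\delta\mathcal{H}=\{\sigma\in\mathcal{H}\mid\tau\in\mathcal{H}\text{ for all non-empty }\tau\subseteq\sigma\}$ (simplicial complexes); $\bar\Delta\mathcal{H}=\{\tau\in\Delta[V]\mid\tau\supseteq\sigma\text{ for some }\sigma\in\mathcal{H}\}$ and $\bar\delta\mathcal{H}=\{\sigma\in\mathcal{H}\mid\tau\in\mathcal{H}\text{ for all }\tau\in\Delta[V],\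 \tau\supseteq\sigma\}$ (independence hypergraphs). A filtration of hypergraphs $\{\mathcal{H}_x\}_{x\in\mathbb{R}}$ is a family of hypergraphs with vertices from $V$ such that $\mathcal{H}_x\subseteq\mathcal{H}_y$ whenever $x\le y$, with inclusions $\iota_x^y$ induced by the identity map of $V$. Operators. $R_n(\mathcal{H})$ is the free $R$-module on the elements of $\mathcal{H}$ with $n+1$ vertices ($R_n=0$ for $n<0$). For $v\in V$ and $v_0\prec\cdots\prec v_n$: $\frac{\partial}{\partial v}\{v_0,\ldots,v_n\}=(-1)^i\{v_0,\ldots,\widehat{v_i},\ldots,v_n\}$ if $v=v_i$ and $n\ge1$, and $0$ otherwise; $dv\{v_0,\ldots,v_n\}=0$ if $v\in\{v_0,\ldots,v_n\}$, and otherwise $(-1)^i\{v_0,\ldots,v_n,v\}$ with $i$ the number of $v_j\prec v$. $\mathrm{Ext}_*(V)$ and $\mathrm{Ext}^*(V)$ are the exterior algebras over $R$ generated by the $\frac{\partial}{\partial v}$, resp. the $dv$, $v\in V$; they act on $R_*(\Delta[V])$ with wedge products acting as compositions. The action of $\mathrm{Ext}_*(V)$ restricts to $R_*(\mathcal{K})$ for a simplicial complex $\mathcal{K}$, and that of $\mathrm{Ext}^*(V)$ to $R_*(\mathcal{L})$ for an independence hypergraph $\mathcal{L}$. Constrained (co)homology. Write $m=\lambda(2t+1)+q$ with $\lambda\in\mathbb{Z}$, $0\le q\le 2t$. $R_*(\mathcal{K},\alpha,m)$ is the chain complex with $n$-th term $R_{(n+\lambda)(2t+1)+q}(\mathcal{K})$,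 $n\ge0$, and boundary map $\alpha$; $R^*(\mathcal{L},\omega,m)$ is the cochain complex with $n$-th term $R_{(n+\lambda)(2t+1)+q}(\mathcal{L})$, $n\ge0$, and coboundary map $\omega$. Their (co)homology groups are $H_n(\mathcal{K},\alpha,m)$ and $H^n(\mathcal{L},\omega,m)$. The actions of $\beta\in\mathrm{Ext}_{2s}(V)$ and $\mu\in\mathrm{Ext}^{2s}(V)$ give (co)chain maps $R_*(\mathcal{K},\alpha,m)\to R_*(\mathcal{K},\alpha,m-2s)$ and $R^*(\mathcal{L},\omega,m)\to R^*(\mathcal{L},\omega,m+2s)$, inducing $\beta_*$ and $\mu_*$ on (co)homology. Mayer–Vietoris sequences. For simplicial complexes $\mathcal{K}_1,\mathcal{K}_2$, $\mathbf{MV}_*(\mathcal{K}_1,\mathcal{K}_2,\alpha,m)$ is the long exact sequence $$\cdots\to H_n(\mathcal{K}_1\cap\mathcal{K}_2,\alpha,m)\to H_n(\mathcal{K}_1,\alpha,m)\oplus H_n(\mathcal{K}_2,\alpha,m)\to H_n(\mathcal{K}_1\cup\mathcal{K}_2,\alpha,m)\to H_{n-1}(\mathcal{K}_1\cap\mathcal{K}_2,\alpha,m)\to\cdots$$ of the short exact sequence $0\to R_*(\mathcal{K}_1\cap\mathcal{K}_2,\alpha,m)\to R_*(\mathcal{K}_1,\alpha,m)\oplus R_*(\mathcal{K}_2,\alpha,m)\to R_*(\mathcal{K}_1\cup\mathcal{K}_2,\alpha,m)\to0$ with maps $x\mapsto(x,x)$, $(y,z)\mapsto y-z$. For independence hypergraphs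 $\mathcal{L}_1,\mathcal{L}_2$, $\mathbf{MV}^*(\mathcal{L}_1,\mathcal{L}_2,\omega,m)$ is the long exact sequence $$\cdots\to H^n(\mathcal{L}_1\cap\mathcal{L}_2,\omega,m)\to H^n(\mathcal{L}_1,\omega,m)\oplus H^n(\mathcal{L}_2,\omega,m)\to H^n(\mathcal{L}_1\cup\mathcal{L}_2,\omega,m)\to H^{n+1}(\mathcal{L}_1\cap\mathcal{L}_2,\omega,m)\to\cdots$$ obtained in the same way. A morphism between such sequences is a family of $R$-module homomorphisms between corresponding terms making the ladder commute. Persistent Mayer–Vietoris sequences. $\mathbf{PMV}_*(\mathcal{H}_x,\mathcal{H}'_x,\alpha,m\mid x\in\mathbb{R})$ consists of the families $\{\mathbf{MV}_*(\delta(\mathcal{H}_x),\delta(\mathcal{H}'_x),\alpha,m)\}_{x\in\mathbb{R}}$ and $\{\mathbf{MV}_*(\Delta(\mathcal{H}_x),\Delta(\mathcal{H}'_x),\alpha,m)\}_{x\in\mathbb{R}}$, together with the morphisms from index $x$ to index $y$ ($x\le y$) induced by the inclusions $\mathcal{H}_x\subseteq\mathcal{H}_y$, $\mathcal{H}'_x\subseteq\mathcal{H}'_y$; for each $x$ the $\delta$-sequence maps to the $\Delta$-sequence by the morphism induced by the inclusions $\delta(\mathcal{H}_x)\subseteq\Delta(\mathcal{H}_x)$, $\delta(\mathcal{H}'_x)\subseteq\Delta(\mathcal{H}'_x)$. $\mathbf{PMV}^*(\mathcal{H}_x,\mathcal{H}'_x,\omega,m\mid x\in\mathbb{R})$ is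 defined in the same way from $\mathbf{MV}^*(\bar\delta(\mathcal{H}_x),\bar\delta(\mathcal{H}'_x),\omega,m)$ and $\mathbf{MV}^*(\bar\Delta(\mathcal{H}_x),\bar\Delta(\mathcal{H}'_x),\omega,m)$. A morphism between persistent Mayer–Vietoris sequences is a family, indexed by $x\in\mathbb{R}$, of pairs of morphisms of Mayer–Vietoris sequences (for $\delta$ and $\Delta$; resp. $\bar\delta$ and $\bar\Delta$) commuting with all the structure morphisms ($x\to y$, and $\delta\to\Delta$, resp. $\bar\delta\to\bar\Delta$). The induced morphisms $\beta_*$, $\mu_*$ are those given on every term by the maps $\beta_*$, $\mu_*$ above. *)

theory Defs
  imports Complex_Main "HOL-Library.Poly_Mapping" "HOL-Algebra.Module"
begin

text \<open>
  The totally ordered vertex set \<open>V\<close> is a type \<open>'v::linorder\<close>; the ring \<open>R\<close> is a type \<open>'r\<close>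
  of class \<^class>\<open>comm_ring_1\<close> (of class \<^class>\<open>idom\<close> in the theorem).
\<close>

section \<open>Hypergraphs\<close>

definition simplices :: "'v set set" where
  "simplices = {\<sigma>. finite \<sigma> \<and> \<sigma> \<noteq> {}}"

definition hypergraph :: "'v set set \<Rightarrow> bool" where
  "hypergraph H \<longleftrightarrow> H \<subseteq> simplices"

definition simp_hull :: "'v set set \<Rightarrow> 'v set set" (\<open>\<Delta>\<close>) where
  "\<Delta> H = {\<tau> \<in> simplices. \<exists>\<sigma>\<in>H. \<tau> \<subseteq> \<sigma>}"

definition simp_core :: "'v set set \<Rightarrow> 'v set set" (\<open>\<delta>\<close>) where
  "\<delta> H = {\<sigma> \<in> H. \<forall>\<tau>. \<tau> \<noteq> {} \<and> \<tau> \<subseteq> \<sigma> \<longrightarrow> \<tau> \<in> H}"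

definition indep_hull :: "'v set set \<Rightarrow> 'v set set" (\<open>\<Delta>bar\<close>) where
  "\<Delta>bar H = {\<tau> \<in> simplices. \<exists>\<sigma>\<in>H. \<sigma> \<subseteq> \<tau>}"

definition indep_core :: "'v set set \<Rightarrow> 'v set set" (\<open>\<delta>bar\<close>) where
  "\<delta>bar H = {\<sigma> \<in> H. \<forall>\<tau>\<in>simplices. \<sigma> \<subseteq> \<tau> \<longrightarrow> \<tau> \<in> H}"

definition hyp_filtration :: "(real \<Rightarrow> 'v set set) \<Rightarrow> bool" where
  "hyp_filtration H \<longleftrightarrow> (\<forall>x. hypergraph (H x)) \<and> (\<forall>x y. x \<le> y \<longrightarrow> H x \<subseteq> H y)"

section \<open>Free modules\<close>

definition scale :: "'r::comm_ring_1 \<Rightarrow> ('a \<Rightarrow>\<^sub>0 'r) \<Rightarrow> ('a \<Rightarrow>\<^sub>0 'r)" where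
  "scale c f = Poly_Mapping.map ((*) c) f"

definition lin_ext :: "('a \<Rightarrow> ('b \<Rightarrow>\<^sub>0 'r)) \<Rightarrow> ('a \<Rightarrow>\<^sub>0 'r::comm_ring_1) \<Rightarrow> ('b \<Rightarrow>\<^sub>0 'r)" where
  "lin_ext g f = (\<Sum>\<sigma>\<in>Poly_Mapping.keys f. scale (Poly_Mapping.lookup f \<sigma>) (g \<sigma>))"

type_synonym ('v, 'r) chain = "'v set \<Rightarrow>\<^sub>0 'r"

text \<open>For a hypergraph \<open>H\<close> this is \<open>{0}\<close> when \<open>n < 0\<close>, since the elements of \<open>H\<close> are finite and
  non-empty.\<close>

definition free_mod :: "int \<Rightarrow> 'v set set \<Rightarrow> ('v, 'r::comm_ring_1) chain set" where
  "free_mod n H = {f. Poly_Mapping.keys f \<subseteq> {\<sigma> \<in> H. int (card \<sigma>) = n + 1}}"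

definition del_op :: "'v::linorder \<Rightarrow> 'v set \<Rightarrow> ('v, 'r::comm_ring_1) chain" where
  "del_op v \<sigma> =
     (if v \<in> \<sigma> \<and> card \<sigma> \<ge> 2
      then Poly_Mapping.single (\<sigma> - {v}) ((-1) ^ card {u \<in> \<sigma>. u < v}) else 0)"

definition ins_op :: "'v::linorder \<Rightarrow> 'v set \<Rightarrow> ('v, 'r::comm_ring_1) chain" where
  "ins_op v \<sigma> =
     (if v \<in> \<sigma> then 0
      else Poly_Mapping.single (insert v \<sigma>) ((-1) ^ card {u \<in> \<sigma>. u < v}))"

section \<open>The exterior algebra on \<open>V\<close> and its two actions\<close>

text \<open>
  The exterior algebra of the free \<open>R\<close>-module on \<open>V\<close> is free on the monomials
  \<open>e_A = e_{a_1} \<and> \<dots> \<and> e_{a_k}\<close>, \<open>A = {a_1 < \<dots> < a_k}\<close> a finite (possibly empty) set of vertices;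
  moving the factors of \<open>e_A \<and> e_B\<close> into increasing order costs one sign for each pair
  \<open>(a, b) \<in> A \<times> B\<close> with \<open>b < a\<close>. The generator \<open>e_v\<close> stands for the operator \<open>\<partial>/\<partial>v\<close> when the algebra
  is used as \<open>Ext\<^sub>*(V)\<close> and for \<open>dv\<close> when it is used as \<open>Ext\<^sup>*(V)\<close>.
\<close>

type_synonym ('v, 'r) ext = "'v set \<Rightarrow>\<^sub>0 'r"

definition ext_deg :: "nat \<Rightarrow> ('v, 'r::comm_ring_1) ext set" where
  "ext_deg k = {\<omega>. \<forall>A\<in>Poly_Mapping.keys \<omega>. finite A \<and> card A = k}"

definition ext_gen :: "'v \<Rightarrow> ('v, 'r::comm_ring_1) ext" where
  "ext_gen v = Poly_Mapping.single {v} 1"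

definition ext_wedge ::
    "('v::linorder, 'r::comm_ring_1) ext \<Rightarrow> ('v, 'r) ext \<Rightarrow> ('v, 'r) ext"  (infixr \<open>\<and>\<^sub>e\<close> 70) where
  "\<omega> \<and>\<^sub>e \<eta> =
     lin_ext (\<lambda>A. lin_ext (\<lambda>B.
        if A \<inter> B = {}
        then Poly_Mapping.single (A \<union> B) ((-1) ^ card {(a, b). a \<in> A \<and> b \<in> B \<and> b < a})
        else 0) \<eta>) \<omega>"

lemma lin_ext_single:
  assumes "c \<noteq> 0" shows "lin_ext g (Poly_Mapping.single a c) = scale c (g a)"
  using assms by (simp add: lin_ext_def)

lemma scale_one: "scale 1 f = f"
  by (rule poly_mapping_eqI) (simp add: scale_def Poly_Mapping.map.rep_eq when_def)

lemma ext_gen_square: "ext_gen v \<and>\<^sub>e ext_gen v = (0 :: ('v::linorder, 'r::comm_ring_1) ext)"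
  by (simp add: ext_wedge_def ext_gen_def lin_ext_single scale_one)

lemma ext_gen_anticomm:
  "ext_gen v \<and>\<^sub>e ext_gen w = - (ext_gen w \<and>\<^sub>e ext_gen v :: ('v::linorder, 'r::comm_ring_1) ext)"
proof -
  have "{(a, b). a = v \<and> b = w \<and> b < a} = (if w < v then {(v, w)} else {})" for v w :: 'v
    by auto
  then show ?thesis
    by (auto simp: ext_wedge_def ext_gen_def lin_ext_single scale_one single_uminus
        insert_commute neq_iff)
qed

lemma ext_monomial:
  assumes "\<And>a. a \<in> A \<Longrightarrow> v < a"
  shows "ext_gen v \<and>\<^sub>e Poly_Mapping.single A 1 =
    (Poly_Mapping.single (insert v A) 1 :: ('v::linorder, 'r::comm_ring_1) ext)"
proof -
  have 1: "v \<notin> A" using assms by blast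
  have 2: "{(a, b). a = v \<and> b \<in> A \<and> b < a} = {}"
    using assms by (auto dest: less_asym)
  show ?thesis using 1 by (simp add: ext_wedge_def ext_gen_def lin_ext_single scale_one 2)
qed

text \<open>\<open>e_A\<close> with \<open>A = {a_1 < \<dots> < a_k}\<close> acts as the composition \<open>op a_1 \<circ> \<dots> \<circ> op a_k\<close>, where
  \<open>op\<close> is \<^const>\<open>del_op\<close> for \<open>Ext\<^sub>*(V)\<close> and \<^const>\<open>ins_op\<close> for \<open>Ext\<^sup>*(V)\<close>.\<close>

definition ext_act ::
    "('v::linorder \<Rightarrow> 'v set \<Rightarrow> ('v, 'r::comm_ring_1) chain) \<Rightarrow> ('v, 'r) ext
      \<Rightarrow> ('v, 'r) chain \<Rightarrow> ('v, 'r) chain" where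
  "ext_act op \<omega> x =
     lin_ext (\<lambda>A. foldr (\<lambda>v. lin_ext (op v)) (sorted_list_of_set A) x) \<omega>"

abbreviation low_act :: "('v::linorder, 'r::comm_ring_1) ext \<Rightarrow> ('v, 'r) chain \<Rightarrow> ('v, 'r) chain" where
  "low_act \<equiv> ext_act del_op"

abbreviation up_act :: "('v::linorder, 'r::comm_ring_1) ext \<Rightarrow> ('v, 'r) chain \<Rightarrow> ('v, 'r) chain" where
  "up_act \<equiv> ext_act ins_op"

section \<open>Complexes and their (co)homology\<close>

text \<open>
  Chain and cochain complexes are treated together. All complexes are indexed by \<open>\<int>\<close>, and are extended
  by \<open>0\<close> in negative degrees; the differential \<open>cdiff C n\<close> goes from degree \<open>n\<close> to
  degree \<open>n + cdir C\<close>, where \<open>cdir C\<close> is \<open>-1\<close> for a chain complex and \<open>1\<close> for a cochain complex.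
\<close>

record 'a cpx =
  cterm :: "int \<Rightarrow> 'a set"
  cdiff :: "int \<Rightarrow> 'a \<Rightarrow> 'a"
  cdir :: int

definition constr_term :: "nat \<Rightarrow> int \<Rightarrow> 'v set set \<Rightarrow> int \<Rightarrow> ('v, 'r::comm_ring_1) chain set" where
  "constr_term t m K n =
     (let p = 2 * int t + 1; l = m div p; q = m mod p
      in if n \<ge> 0 then free_mod ((n + l) * p + q) K else {0})"

definition chain_cpx :: "nat \<Rightarrow> ('v::linorder, 'r::comm_ring_1) ext \<Rightarrow> int \<Rightarrow> 'v set set
    \<Rightarrow> ('v, 'r) chain cpx" where
  "chain_cpx t \<alpha> m K =
     \<lparr>cterm = constr_term t m K,
      cdiff = (\<lambda>n x. if n \<ge> 1 then low_act \<alpha> x else 0),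
      cdir = -1\<rparr>"

definition cochain_cpx :: "nat \<Rightarrow> ('v::linorder, 'r::comm_ring_1) ext \<Rightarrow> int \<Rightarrow> 'v set set
    \<Rightarrow> ('v, 'r) chain cpx" where
  "cochain_cpx t \<omega> m L =
     \<lparr>cterm = constr_term t m L,
      cdiff = (\<lambda>n x. if n \<ge> 0 then up_act \<omega> x else 0),
      cdir = 1\<rparr>"

definition cycles :: "('v, 'r::comm_ring_1) chain cpx \<Rightarrow> int \<Rightarrow> ('v, 'r) chain set" where
  "cycles C n = {z \<in> cterm C n. cdiff C n z = 0}"

definition boundaries :: "('v, 'r::comm_ring_1) chain cpx \<Rightarrow> int \<Rightarrow> ('v, 'r) chain set" where
  "boundaries C n = cdiff C (n - cdir C) ` cterm C (n - cdir C)"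

definition hclass :: "('v, 'r::comm_ring_1) chain cpx \<Rightarrow> int \<Rightarrow> ('v, 'r) chain \<Rightarrow> ('v, 'r) chain set" where
  "hclass C n z = {z + b | b. b \<in> boundaries C n}"

text \<open>The quotient module of cycles modulo boundaries, its elements being cosets. The fields
  \<^const>\<open>mult\<close> and \<^const>\<open>one\<close> of a module record play no role.\<close>

definition homology :: "('v, 'r::comm_ring_1) chain cpx \<Rightarrow> int \<Rightarrow> ('r, ('v, 'r) chain set) module" where
  "homology C n =
     \<lparr>carrier = hclass C n ` cycles C n,
      mult = undefined, one = undefined,
      zero = boundaries C n,
      add = (\<lambda>c c'. {x + y | x y. x \<in> c \<and> y \<in> c'}),
      smult = (\<lambda>r c. {scale r x + b | x b. x \<in> c \<and> b \<in> boundaries C n})\<rparr>"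

definition dir_sum :: "('r, 'a) module \<Rightarrow> ('r, 'b) module \<Rightarrow> ('r, 'a \<times> 'b) module" where
  "dir_sum M N =
     \<lparr>carrier = carrier M \<times> carrier N,
      mult = undefined, one = undefined,
      zero = (\<zero>\<^bsub>M\<^esub>, \<zero>\<^bsub>N\<^esub>),
      add = (\<lambda>(a, b) (a', b'). (a \<oplus>\<^bsub>M\<^esub> a', b \<oplus>\<^bsub>N\<^esub> b')),
      smult = (\<lambda>r (a, b). (r \<odot>\<^bsub>M\<^esub> a, r \<odot>\<^bsub>N\<^esub> b))\<rparr>"

definition mod_hom :: "('r, 'a) module \<Rightarrow> ('r, 'b) module \<Rightarrow> ('a \<Rightarrow> 'b) set" where
  "mod_hom M N =
     {h. h \<in> carrier M \<rightarrow> carrier N \<and>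
         (\<forall>x\<in>carrier M. \<forall>y\<in>carrier M. h (x \<oplus>\<^bsub>M\<^esub> y) = h x \<oplus>\<^bsub>N\<^esub> h y) \<and>
         (\<forall>r. \<forall>x\<in>carrier M. h (r \<odot>\<^bsub>M\<^esub> x) = r \<odot>\<^bsub>N\<^esub> h x)}"

text \<open>The map \<open>[z] \<mapsto> [f z]\<close> on homology induced by a (co)chain map \<open>f\<close> with target \<open>D\<close>: for
  \<open>c = [z]\<close> the set below is the coset of \<open>f z\<close>.\<close>

definition hmap :: "('v, 'r::comm_ring_1) chain cpx \<Rightarrow> int \<Rightarrow> (('v, 'r) chain \<Rightarrow> ('v, 'r) chain)
    \<Rightarrow> ('v, 'r) chain set \<Rightarrow> ('v, 'r) chain set" where
  "hmap D n f c = {f z + b | z b. z \<in> c \<and> b \<in> boundaries D n}"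

section \<open>Mayer--Vietoris sequences\<close>

text \<open>
  A sequence \<open>\<dots> \<rightarrow> I n \<rightarrow> S n \<rightarrow> U n \<rightarrow> I (n + dir) \<rightarrow> \<dots>\<close> of modules and maps, \<open>n \<in> \<int>\<close>.
\<close>

record ('r, 'a) mvseq =
  mvI :: "int \<Rightarrow> ('r, 'a) module"
  mvS :: "int \<Rightarrow> ('r, 'a \<times> 'a) module"
  mvU :: "int \<Rightarrow> ('r, 'a) module"
  mvIS :: "int \<Rightarrow> 'a \<Rightarrow> 'a \<times> 'a"
  mvSU :: "int \<Rightarrow> 'a \<times> 'a \<Rightarrow> 'a"
  mvUI :: "int \<Rightarrow> 'a \<Rightarrow> 'a"
  mvdir :: int

text \<open>\<open>F\<close> assigns to a hypergraph its (co)chain complex. The map \<^const>\<open>mvUI\<close> is the connecting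
  homomorphism of \<open>0 \<rightarrow> F (K1 \<inter> K2) \<rightarrow> F K1 \<oplus> F K2 \<rightarrow> F (K1 \<union> K2) \<rightarrow> 0\<close>: lift a representative of
  the class \<open>c\<close> to a pair \<open>(y, z)\<close> with \<open>y - z \<in> c\<close>; then \<open>(dy, dz)\<close> is the image of
  \<open>dy = dz\<close> under \<open>x \<mapsto> (x, x)\<close>, and the value is the class of \<open>dy\<close>.\<close>

definition mv :: "('v set set \<Rightarrow> ('v, 'r::comm_ring_1) chain cpx) \<Rightarrow> 'v set set \<Rightarrow> 'v set set
    \<Rightarrow> ('r, ('v, 'r) chain set) mvseq" where
  "mv F K1 K2 =
     \<lparr>mvI = homology (F (K1 \<inter> K2)),
      mvS = (\<lambda>n. dir_sum (homology (F K1) n) (homology (F K2) n)),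
      mvU = homology (F (K1 \<union> K2)),
      mvIS = (\<lambda>n c. (hmap (F K1) n id c, hmap (F K2) n id c)),
      mvSU = (\<lambda>n (a, b). {y - z + w | y z w.
                 y \<in> a \<and> z \<in> b \<and> w \<in> boundaries (F (K1 \<union> K2)) n}),
      mvUI = (\<lambda>n c. {cdiff (F K1) n y + w | y z w.
                 y \<in> cterm (F K1) n \<and> z \<in> cterm (F K2) n \<and> y - z \<in> c \<and>
                 w \<in> boundaries (F (K1 \<inter> K2)) (n + cdir (F (K1 \<inter> K2)))}),
      mvdir = cdir (F (K1 \<inter> K2))\<rparr>"

record 'a mvmor =
  morI :: "int \<Rightarrow> 'a \<Rightarrow> 'a"
  morS :: "int \<Rightarrow> 'a \<times> 'a \<Rightarrow> 'a \<times> 'a"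
  morU :: "int \<Rightarrow> 'a \<Rightarrow> 'a"

definition mv_morphism :: "('r, 'a) mvseq \<Rightarrow> ('r, 'a) mvseq \<Rightarrow> 'a mvmor \<Rightarrow> bool" where
  "mv_morphism M N \<phi> \<longleftrightarrow>
     mvdir M = mvdir N \<and>
     (\<forall>n. morI \<phi> n \<in> mod_hom (mvI M n) (mvI N n) \<and>
          morS \<phi> n \<in> mod_hom (mvS M n) (mvS N n) \<and>
          morU \<phi> n \<in> mod_hom (mvU M n) (mvU N n) \<and>
          (\<forall>c\<in>carrier (mvI M n). morS \<phi> n (mvIS M n c) = mvIS N n (morI \<phi> n c)) \<and>
          (\<forall>c\<in>carrier (mvS M n). morU \<phi> n (mvSU M n c) = mvSU N n (morS \<phi> n c)) \<and>
          (\<forall>c\<in>carrier (mvU M n).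
             morI \<phi> (n + mvdir M) (mvUI M n c) = mvUI N n (morU \<phi> n c)))"

definition mv_comp :: "'a mvmor \<Rightarrow> 'a mvmor \<Rightarrow> 'a mvmor" where
  "mv_comp \<psi> \<phi> = \<lparr>morI = (\<lambda>n. morI \<psi> n \<circ> morI \<phi> n),
                  morS = (\<lambda>n. morS \<psi> n \<circ> morS \<phi> n),
                  morU = (\<lambda>n. morU \<psi> n \<circ> morU \<phi> n)\<rparr>"

text \<open>Equality of morphisms with source \<open>M\<close>.\<close>

definition mv_eq :: "('r, 'a) mvseq \<Rightarrow> 'a mvmor \<Rightarrow> 'a mvmor \<Rightarrow> bool" where
  "mv_eq M \<phi> \<psi> \<longleftrightarrow>
     (\<forall>n. (\<forall>c\<in>carrier (mvI M n). morI \<phi> n c = morI \<psi> n c) \<and>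
          (\<forall>c\<in>carrier (mvS M n). morS \<phi> n c = morS \<psi> n c) \<and>
          (\<forall>c\<in>carrier (mvU M n). morU \<phi> n c = morU \<psi> n c))"

text \<open>The morphism given on every term by the map induced by \<open>f\<close>, with target \<open>mv F K1 K2\<close>.\<close>

definition mv_induced :: "(('v, 'r::comm_ring_1) chain \<Rightarrow> ('v, 'r) chain)
    \<Rightarrow> ('v set set \<Rightarrow> ('v, 'r) chain cpx) \<Rightarrow> 'v set set \<Rightarrow> 'v set set
    \<Rightarrow> ('v, 'r) chain set mvmor" where
  "mv_induced f F K1 K2 =
     \<lparr>morI = (\<lambda>n. hmap (F (K1 \<inter> K2)) n f),
      morS = (\<lambda>n. map_prod (hmap (F K1) n f) (hmap (F K2) n f)),
      morU = (\<lambda>n. hmap (F (K1 \<union> K2)) n f)\<rparr>"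

section \<open>Persistent Mayer--Vietoris sequences\<close>

text \<open>\<open>inner\<close> and \<open>outer\<close> are the two families of sequences (for \<open>\<delta>\<close> and \<open>\<Delta>\<close>, resp. their
  independence versions); the other fields are the structure morphisms \<open>x \<rightarrow> y\<close> (\<open>x \<le> y\<close>) of each
  family and \<open>inner \<rightarrow> outer\<close>.\<close>

record ('r, 'a) pmvseq =
  inner :: "real \<Rightarrow> ('r, 'a) mvseq"
  outer :: "real \<Rightarrow> ('r, 'a) mvseq"
  inner_str :: "real \<Rightarrow> real \<Rightarrow> 'a mvmor"
  outer_str :: "real \<Rightarrow> real \<Rightarrow> 'a mvmor"
  in_out :: "real \<Rightarrow> 'a mvmor"

definition pmv :: "('v set set \<Rightarrow> ('v, 'r::comm_ring_1) chain cpx)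
    \<Rightarrow> ('v set set \<Rightarrow> 'v set set) \<Rightarrow> ('v set set \<Rightarrow> 'v set set)
    \<Rightarrow> (real \<Rightarrow> 'v set set) \<Rightarrow> (real \<Rightarrow> 'v set set) \<Rightarrow> ('r, ('v, 'r) chain set) pmvseq" where
  "pmv F cor clo H H' =
     \<lparr>inner = (\<lambda>x. mv F (cor (H x)) (cor (H' x))),
      outer = (\<lambda>x. mv F (clo (H x)) (clo (H' x))),
      inner_str = (\<lambda>x y. mv_induced id F (cor (H y)) (cor (H' y))),
      outer_str = (\<lambda>x y. mv_induced id F (clo (H y)) (clo (H' y))),
      in_out = (\<lambda>x. mv_induced id F (clo (H x)) (clo (H' x)))\<rparr>"

type_synonym 'a pmvmor = "real \<Rightarrow> 'a mvmor \<times> 'a mvmor"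

definition pmv_morphism :: "('r, 'a) pmvseq \<Rightarrow> ('r, 'a) pmvseq \<Rightarrow> 'a pmvmor \<Rightarrow> bool" where
  "pmv_morphism P Q \<Phi> \<longleftrightarrow>
     (\<forall>x. mv_morphism (inner P x) (inner Q x) (fst (\<Phi> x)) \<and>
          mv_morphism (outer P x) (outer Q x) (snd (\<Phi> x))) \<and>
     (\<forall>x y. x \<le> y \<longrightarrow>
        mv_eq (inner P x) (mv_comp (fst (\<Phi> y)) (inner_str P x y))
                          (mv_comp (inner_str Q x y) (fst (\<Phi> x))) \<and>
        mv_eq (outer P x) (mv_comp (snd (\<Phi> y)) (outer_str P x y))
                          (mv_comp (outer_str Q x y) (snd (\<Phi> x)))) \<and>
     (\<forall>x. mv_eq (inner P x) (mv_comp (snd (\<Phi> x)) (in_out P x))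
                            (mv_comp (in_out Q x) (fst (\<Phi> x))))"

definition pmv_comp :: "'a pmvmor \<Rightarrow> 'a pmvmor \<Rightarrow> 'a pmvmor" where
  "pmv_comp \<Psi> \<Phi> = (\<lambda>x. (mv_comp (fst (\<Psi> x)) (fst (\<Phi> x)), mv_comp (snd (\<Psi> x)) (snd (\<Phi> x))))"

definition pmv_eq :: "('r, 'a) pmvseq \<Rightarrow> 'a pmvmor \<Rightarrow> 'a pmvmor \<Rightarrow> bool" where
  "pmv_eq P \<Phi> \<Psi> \<longleftrightarrow>
     (\<forall>x. mv_eq (inner P x) (fst (\<Phi> x)) (fst (\<Psi> x)) \<and> mv_eq (outer P x) (snd (\<Phi> x)) (snd (\<Psi> x)))"

definition pmv_induced :: "(('v, 'r::comm_ring_1) chain \<Rightarrow> ('v, 'r) chain)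
    \<Rightarrow> ('v set set \<Rightarrow> ('v, 'r) chain cpx)
    \<Rightarrow> ('v set set \<Rightarrow> 'v set set) \<Rightarrow> ('v set set \<Rightarrow> 'v set set)
    \<Rightarrow> (real \<Rightarrow> 'v set set) \<Rightarrow> (real \<Rightarrow> 'v set set) \<Rightarrow> ('v, 'r) chain set pmvmor" where
  "pmv_induced f F cor clo H H' =
     (\<lambda>x. (mv_induced f F (cor (H x)) (cor (H' x)), mv_induced f F (clo (H x)) (clo (H' x))))"

definition PMV_low :: "nat \<Rightarrow> (real \<Rightarrow> 'v set set) \<Rightarrow> (real \<Rightarrow> 'v set set)
    \<Rightarrow> ('v::linorder, 'r::comm_ring_1) ext \<Rightarrow> int \<Rightarrow> ('r, ('v, 'r) chain set) pmvseq" where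
  "PMV_low t H H' \<alpha> m = pmv (chain_cpx t \<alpha> m) \<delta> \<Delta> H H'"

definition PMV_up :: "nat \<Rightarrow> (real \<Rightarrow> 'v set set) \<Rightarrow> (real \<Rightarrow> 'v set set)
    \<Rightarrow> ('v::linorder, 'r::comm_ring_1) ext \<Rightarrow> int \<Rightarrow> ('r, ('v, 'r) chain set) pmvseq" where
  "PMV_up t H H' \<omega> m = pmv (cochain_cpx t \<omega> m) \<delta>bar \<Delta>bar H H'"

text \<open>\<open>\<beta>\<^sub>*\<close> and \<open>\<mu>\<^sub>*\<close> as morphisms with target \<open>PMV_low t H H' \<alpha> m\<close>, resp. \<open>PMV_up t H H' \<omega> m\<close>:
  \<open>m\<close> is the parameter of the target, not of the source.\<close>

definition low_star :: "nat \<Rightarrow> (real \<Rightarrow> 'v set set) \<Rightarrow> (real \<Rightarrow> 'v set set)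
    \<Rightarrow> ('v::linorder, 'r::comm_ring_1) ext \<Rightarrow> int \<Rightarrow> ('v, 'r) ext \<Rightarrow> ('v, 'r) chain set pmvmor" where
  "low_star t H H' \<alpha> m \<beta> = pmv_induced (low_act \<beta>) (chain_cpx t \<alpha> m) \<delta> \<Delta> H H'"

definition up_star :: "nat \<Rightarrow> (real \<Rightarrow> 'v set set) \<Rightarrow> (real \<Rightarrow> 'v set set)
    \<Rightarrow> ('v::linorder, 'r::comm_ring_1) ext \<Rightarrow> int \<Rightarrow> ('v, 'r) ext \<Rightarrow> ('v, 'r) chain set pmvmor" where
  "up_star t H H' \<omega> m \<mu> = pmv_induced (up_act \<mu>) (cochain_cpx t \<omega> m) \<delta>bar \<Delta>bar H H'"

end

theory Submission
  imports Defs
begin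

text \<open>
  The statement is naturality of the Mayer--Vietoris sequence, applied to chain maps that commute with
  the differentials and compose well because the exterior algebra is graded commutative.

  The operators \<open>\<partial>/\<partial>v\<close> anticommute and square to zero on finite simplices, and so do the operators \<open>dv\<close>.
  Hence a product of monomials in the exterior algebra acts as the composition of their actions
  (\<open>ext_act_wedge\<close>). Elements of even degree commute with everything (\<open>ext_wedge_even_commute\<close>), so the
  actions of \<open>\<beta>\<close> and \<open>\<mu>\<close> commute with the differentials \<open>\<alpha>\<close> and \<open>\<omega>\<close>, and the actions of \<open>\<beta>1\<close> and \<open>\<beta>2\<close>
  (of \<open>\<mu>1\<close> and \<open>\<mu>2\<close>) commute with each other. Elements of odd degree square to minus their own square,
  hence to \<open>0\<close> as \<open>2\<close> is invertible (\<open>ext_wedge_odd_square\<close>); so \<open>\<alpha>\<close> and \<open>\<omega>\<close> are differentials.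

  For simplicial complexes, and equally for independence hypergraphs, chains on a union are differences
  of chains on the two parts, and chains on an intersection are the common chains. This short exact
  sequence makes the connecting homomorphism a well-defined map \<open>[y - z] \<mapsto> [dy]\<close> (\<open>mvUI_hclass\<close>).
  All other maps of the ladder, too, act on homology classes by a formula in representatives, so that
  commuting with a chain map \<open>f\<close> is read off from representatives (\<open>mv_morphism_induced\<close>). The squares of
  the persistent sequences and the multiplicativity of \<open>\<beta> \<mapsto> \<beta>\<^sub>*\<close> are equalities between composites of
  maps \<open>[z] \<mapsto> [f z]\<close>, hence again equalities between representatives (\<open>mv_eq_compose\<close>).

  The two halves are instances of one locale, \<open>ext_action\<close>: the operators lower the dimension by one in
  the first and raise it by one in the second.
\<close>

section \<open>Linear maps between free modules\<close>

lemma lookup_scale: "Poly_Mapping.lookup (scale c f) a = c * Poly_Mapping.lookup f a"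
  by (simp add: scale_def Poly_Mapping.map.rep_eq when_def)

interpretation chain: Modules.module scale
  by unfold_locales
    (auto intro!: poly_mapping_eqI simp: lookup_scale lookup_add algebra_simps)

abbreviation chain_hom ::
    "(('a \<Rightarrow>\<^sub>0 'r::comm_ring_1) \<Rightarrow> ('b \<Rightarrow>\<^sub>0 'r)) \<Rightarrow> bool" where
  "chain_hom \<equiv> Modules.module_hom scale scale"

lemma chain_homI:
  assumes "\<And>x y. f (x + y) = f x + f y" "\<And>c x. f (scale c x) = scale c (f x)"
  shows "chain_hom f"
  using assms by unfold_locales auto

lemma chain_hom_id: "chain_hom id"
  by (rule chain_homI) auto

lemma scale_hom: "chain_hom (scale c)"
  by (rule chain_homI) (simp_all add: chain.scale_right_distrib mult.commute)

lemma chain_hom_compose: "chain_hom f \<Longrightarrow> chain_hom g \<Longrightarrow> chain_hom (\<lambda>x. f (g x))"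
  by (rule chain_homI) (simp_all add: module_hom.add module_hom.scale)

lemma scale_single: "scale c (Poly_Mapping.single a d) = Poly_Mapping.single a (c * d)"
  by (rule poly_mapping_eqI) (simp add: lookup_scale lookup_single when_def)

lemma lin_ext_superset:
  assumes "finite S" "Poly_Mapping.keys f \<subseteq> S"
  shows "lin_ext g f = (\<Sum>a\<in>S. scale (Poly_Mapping.lookup f a) (g a))"
  unfolding lin_ext_def using assms
  by (intro sum.mono_neutral_left) (auto simp: in_keys_iff)

lemma lin_ext_hom:
  fixes g :: "'a \<Rightarrow> ('b \<Rightarrow>\<^sub>0 'r::comm_ring_1)"
  shows "chain_hom (lin_ext g)"
proof (rule chain_homI)
  fix x y :: "'a \<Rightarrow>\<^sub>0 'r"
  let ?S = "Poly_Mapping.keys x \<union> Poly_Mapping.keys y"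
  have "Poly_Mapping.keys (x + y) \<subseteq> ?S"
    by (rule Poly_Mapping.keys_add)
  then show "lin_ext g (x + y) = lin_ext g x + lin_ext g y"
    by (simp add: lin_ext_superset[of ?S] lookup_add chain.scale_left_distrib sum.distrib)
next
  fix c and x :: "'a \<Rightarrow>\<^sub>0 'r"
  have "Poly_Mapping.keys (scale c x) \<subseteq> Poly_Mapping.keys x"
    by (auto simp: in_keys_iff lookup_scale)
  then show "lin_ext g (scale c x) = scale c (lin_ext g x)"
    by (simp add: lin_ext_superset[of "Poly_Mapping.keys x"] lookup_scale
        chain.scale_sum_right)
qed

lemmas lin_ext_zero [simp] = module_hom.zero[OF lin_ext_hom]
lemmas lin_ext_scale = module_hom.scale[OF lin_ext_hom]

lemma lin_ext_monomial: "lin_ext g (Poly_Mapping.single a c) = scale c (g a)"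
  by (subst lin_ext_superset[of "{a}"]) auto

lemma lin_ext_cong:
  "(\<And>a. a \<in> Poly_Mapping.keys f \<Longrightarrow> g a = h a) \<Longrightarrow> lin_ext g f = lin_ext h f"
  by (simp add: lin_ext_def)

text \<open>A linear map is determined by its values on basis elements; this reduces the operator identities
  below to identities on single simplices and single monomials.\<close>

lemma hom_lin_ext:
  assumes "chain_hom T"
  shows "T (lin_ext g f) = lin_ext (\<lambda>a. T (g a)) f"
  by (simp add: lin_ext_def module_hom.sum[OF assms] module_hom.scale[OF assms])

lemma lin_ext_add_fun: "lin_ext (\<lambda>a. g a + h a) f = lin_ext g f + lin_ext h f"
  by (simp add: lin_ext_def chain.scale_right_distrib sum.distrib)

lemma lin_ext_scale_fun: "lin_ext (\<lambda>a. scale c (g a)) f = scale c (lin_ext g f)"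
  by (simp add: lin_ext_def chain.scale_sum_right mult.commute)

lemma lin_ext_uminus_fun: "lin_ext (\<lambda>a. - g a) f = - lin_ext g f"
  by (simp add: lin_ext_def sum_negf)

lemma lin_ext_zero_fun: "lin_ext (\<lambda>a. 0) f = 0"
  by (simp add: lin_ext_def)

lemma lin_ext_swap:
  "lin_ext (\<lambda>a. lin_ext (\<lambda>b. g a b) y) x = lin_ext (\<lambda>b. lin_ext (\<lambda>a. g a b) x) y"
  unfolding lin_ext_def chain.scale_sum_right
  by (subst sum.swap) (simp add: mult.commute)

lemma lin_ext_in_subspace:
  assumes "chain.subspace S" "\<And>a. a \<in> Poly_Mapping.keys f \<Longrightarrow> g a \<in> S"
  shows "lin_ext g f \<in> S"
  unfolding lin_ext_def using assms by (auto intro!: chain.subspace_sum chain.subspace_scale)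

lemma supported_subspace: "chain.subspace {f. Poly_Mapping.keys f \<subseteq> S}"
proof -
  have eq: "{f. Poly_Mapping.keys f \<subseteq> S} = {f. \<forall>a. a \<notin> S \<longrightarrow> Poly_Mapping.lookup f a = 0}"
    by (auto simp: in_keys_iff)
  show ?thesis
    unfolding eq by (simp add: chain.subspace_def lookup_add lookup_scale)
qed

lemma ext_deg_alt: "ext_deg k = {\<omega>. Poly_Mapping.keys \<omega> \<subseteq> {A. finite A \<and> card A = k}}"
  by (auto simp: ext_deg_def)

lemma ext_deg_subspace: "chain.subspace (ext_deg k)"
  unfolding ext_deg_alt by (rule supported_subspace)

lemma free_mod_subspace: "chain.subspace (free_mod n K)"
  unfolding free_mod_def by (rule supported_subspace)

section \<open>Graded commutativity of the exterior algebra\<close>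

abbreviation inversions :: "'v::linorder set \<Rightarrow> 'v set \<Rightarrow> ('v \<times> 'v) set" where
  "inversions A B \<equiv> {(a, b). a \<in> A \<and> b \<in> B \<and> b < a}"

lemma finite_inversions: "finite A \<Longrightarrow> finite B \<Longrightarrow> finite (inversions A B)"
  by (rule finite_subset[of _ "A \<times> B"]) auto

text \<open>For disjoint \<open>A\<close> and \<open>B\<close> every pair in \<open>A \<times> B\<close> is out of order in exactly one of the two
  arrangements.\<close>

lemma inversions_swap:
  assumes "finite A" "finite B" "A \<inter> B = {}"
  shows "card (inversions A B) + card (inversions B A) = card A * card B"
proof -
  let ?I = "inversions A B" and ?J = "prod.swap ` inversions B A"
  have "card A * card B = card (?I \<union> ?J)"
    using assms(3) by (subst card_cartesian_product[symmetric]) (force intro!: arg_cong[of _ _ card])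
  also have "\<dots> = card ?I + card ?J"
    using assms(1,2) by (intro card_Un_disjoint finite_imageI finite_inversions) auto
  also have "card ?J = card (inversions B A)"
    by (simp add: card_image)
  finally show ?thesis by simp
qed

lemma inversion_sign_swap:
  assumes "finite A" "finite B" "A \<inter> B = {}"
  shows "(-1 :: 'r::comm_ring_1) ^ card (inversions A B) =
    (-1) ^ (card A * card B) * (-1) ^ card (inversions B A)"
proof -
  have "(-1 :: 'r) ^ (card A * card B) * (-1) ^ card (inversions B A) =
      (-1) ^ card (inversions A B) * ((-1) ^ card (inversions B A) * (-1) ^ card (inversions B A))"
    by (simp add: inversions_swap[OF assms, symmetric] power_add mult.assoc)
  also have "(-1 :: 'r) ^ card (inversions B A) * (-1) ^ card (inversions B A) = 1"
    by (simp flip: power_mult_distrib)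
  finally show ?thesis by simp
qed

lemma ext_wedge_graded_commute:
  fixes \<omega> \<eta> :: "('v::linorder, 'r::comm_ring_1) ext"
  assumes "\<omega> \<in> ext_deg j" "\<eta> \<in> ext_deg k"
  shows "\<omega> \<and>\<^sub>e \<eta> = scale ((-1) ^ (j * k)) (\<eta> \<and>\<^sub>e \<omega>)"
proof -
  have "\<omega> \<and>\<^sub>e \<eta> = lin_ext (\<lambda>A. lin_ext (\<lambda>B. scale ((-1) ^ (j * k)) (if B \<inter> A = {}
        then Poly_Mapping.single (B \<union> A) ((-1) ^ card (inversions B A)) else 0)) \<eta>) \<omega>"
    unfolding ext_wedge_def
  proof (intro lin_ext_cong)
    fix A B assume "A \<in> Poly_Mapping.keys \<omega>" "B \<in> Poly_Mapping.keys \<eta>"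
    then have AB: "finite A" "finite B" "card A = j" "card B = k"
      using assms by (auto simp: ext_deg_def)
    show "(if A \<inter> B = {} then Poly_Mapping.single (A \<union> B) ((-1) ^ card (inversions A B)) else 0) =
        scale ((-1) ^ (j * k)) (if B \<inter> A = {}
        then Poly_Mapping.single (B \<union> A) ((-1) ^ card (inversions B A)) else 0)"
    proof (cases "A \<inter> B = {}")
      case True
      then show ?thesis
        unfolding inversion_sign_swap[OF AB(1,2) True]
        by (simp add: scale_single AB(3,4) Un_commute Int_commute)
    qed (auto simp: Int_commute)
  qed
  also have "\<dots> = scale ((-1) ^ (j * k)) (\<eta> \<and>\<^sub>e \<omega>)"
    unfolding ext_wedge_def lin_ext_scale_fun by (subst lin_ext_swap) simp
  finally show ?thesis .
qed

lemma ext_wedge_even_commute: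
  "\<omega> \<in> ext_deg j \<Longrightarrow> \<eta> \<in> ext_deg k \<Longrightarrow> even j \<Longrightarrow> \<omega> \<and>\<^sub>e \<eta> = \<eta> \<and>\<^sub>e \<omega>"
  by (simp add: ext_wedge_graded_commute[of \<omega> j \<eta> k])

text \<open>Graded commutativity alone gives \<open>2 (\<omega> \<and> \<omega>) = 0\<close>; invertibility of \<open>2\<close> cancels the factor.\<close>

lemma ext_wedge_odd_square:
  fixes \<omega> :: "('v::linorder, 'r::comm_ring_1) ext"
  assumes "\<omega> \<in> ext_deg k" "odd k" "(2 :: 'r) dvd 1"
  shows "\<omega> \<and>\<^sub>e \<omega> = 0"
proof -
  obtain h :: 'r where h: "1 = 2 * h" using assms(3) by (elim dvdE)
  have "\<omega> \<and>\<^sub>e \<omega> = - (\<omega> \<and>\<^sub>e \<omega>)"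
    using ext_wedge_graded_commute[OF assms(1,1)] assms(2) by simp
  then have "\<omega> \<and>\<^sub>e \<omega> + \<omega> \<and>\<^sub>e \<omega> = 0"
    by (metis add.right_inverse)
  then have "scale h (\<omega> \<and>\<^sub>e \<omega> + \<omega> \<and>\<^sub>e \<omega>) = 0"
    by simp
  then have "scale (2 * h) (\<omega> \<and>\<^sub>e \<omega>) = 0"
    by (simp only: chain.scale_right_distrib mult_2 chain.scale_left_distrib)
  then show ?thesis
    by (simp only: h[symmetric] chain.scale_one)
qed

lemma ext_wedge_deg:
  assumes "\<omega> \<in> ext_deg j" "\<eta> \<in> ext_deg k"
  shows "\<omega> \<and>\<^sub>e \<eta> \<in> ext_deg (j + k)"
  unfolding ext_wedge_def
proof (intro lin_ext_in_subspace ext_deg_subspace)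
  fix A B assume "A \<in> Poly_Mapping.keys \<omega>" "B \<in> Poly_Mapping.keys \<eta>"
  then have "finite A" "finite B" "card A = j" "card B = k"
    using assms by (auto simp: ext_deg_def)
  then show "(if A \<inter> B = {} then Poly_Mapping.single (A \<union> B) ((-1) ^ card (inversions A B)) else 0)
      \<in> ext_deg (j + k)"
    by (auto simp: ext_deg_def card_Un_disjoint)
qed

section \<open>The action of the exterior algebra\<close>

text \<open>The sign \<open>(-1) ^ card {u \<in> \<sigma>. u < v}\<close> counts vertices only if \<open>\<sigma>\<close> is finite. On infinite sets
  \<open>card\<close> defaults to \<open>0\<close> and the operators \<open>dv\<close> need not anticommute, so the identities are proved on
  chains of finite sets.\<close>

definition fin_chains :: "('v, 'r::comm_ring_1) chain set" where
  "fin_chains = {x. Poly_Mapping.keys x \<subseteq> {\<sigma>. finite \<sigma>}}"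

lemma fin_chains_subspace: "chain.subspace fin_chains"
  unfolding fin_chains_def by (rule supported_subspace)

text \<open>The defining relations of the exterior algebra, imposed on operators. They make the action of
  monomials extend to an action of the algebra.\<close>

locale anticommuting =
  fixes op :: "'v::linorder \<Rightarrow> 'v set \<Rightarrow> ('v, 'r::comm_ring_1) chain"
  assumes op_fin: "finite \<sigma> \<Longrightarrow> op v \<sigma> \<in> fin_chains"
    and op_square: "finite \<sigma> \<Longrightarrow> lin_ext (op v) (op v \<sigma>) = 0"
    and op_anticommute:
      "finite \<sigma> \<Longrightarrow> v < w \<Longrightarrow> lin_ext (op w) (op v \<sigma>) = - lin_ext (op v) (op w \<sigma>)"
begin

abbreviation D :: "'v \<Rightarrow> ('v, 'r) chain \<Rightarrow> ('v, 'r) chain" where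
  "D v \<equiv> lin_ext (op v)"

definition mono_act :: "'v set \<Rightarrow> ('v, 'r) chain \<Rightarrow> ('v, 'r) chain" where
  "mono_act A = foldr D (sorted_list_of_set A)"

lemma ext_act_mono_act: "ext_act op \<omega> x = lin_ext (\<lambda>A. mono_act A x) \<omega>"
  by (simp add: ext_act_def mono_act_def)

lemma mono_act_empty: "mono_act {} x = x"
  by (simp add: mono_act_def)

lemma mono_act_insert_min:
  assumes "finite A" "\<And>a. a \<in> A \<Longrightarrow> v < a"
  shows "mono_act (insert v A) x = D v (mono_act A x)"
proof -
  have "sorted_list_of_set (insert v A) = v # sorted_list_of_set A"
    using assms sorted_list_of_set_nonempty[of "insert v A"]
    by (metis Diff_insert_absorb Min_insert2 finite.insertI insert_not_empty less_imp_le order_less_irrefl)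
  then show ?thesis by (simp add: mono_act_def)
qed

lemma foldr_hom: "chain_hom (foldr D vs)"
proof (induction vs)
  case Nil
  then show ?case using chain_hom_id by (simp add: id_def)
next
  case (Cons v vs)
  then show ?case using chain_hom_compose[OF lin_ext_hom Cons] by (simp add: comp_def)
qed

lemma mono_act_hom: "chain_hom (mono_act A)"
  unfolding mono_act_def by (rule foldr_hom)

lemma ext_act_hom: "chain_hom (ext_act op \<omega>)"
  by (rule chain_homI)
    (simp_all add: ext_act_mono_act module_hom.add[OF mono_act_hom]
      module_hom.scale[OF mono_act_hom] lin_ext_add_fun lin_ext_scale_fun)

lemma D_fin: "x \<in> fin_chains \<Longrightarrow> D v x \<in> fin_chains"
  using op_fin by (intro lin_ext_in_subspace[OF fin_chains_subspace]) (auto simp: fin_chains_def)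

lemma mono_act_fin: "x \<in> fin_chains \<Longrightarrow> mono_act A x \<in> fin_chains"
proof -
  assume x: "x \<in> fin_chains"
  have "foldr D vs x \<in> fin_chains" for vs
    by (induction vs) (simp_all add: x D_fin)
  then show ?thesis by (simp add: mono_act_def)
qed

lemma D_square: "x \<in> fin_chains \<Longrightarrow> D v (D v x) = 0"
  unfolding hom_lin_ext[OF lin_ext_hom, of "op v"]
  by (subst lin_ext_cong[where h = "\<lambda>_. 0"]) (auto simp: fin_chains_def op_square lin_ext_zero_fun)

lemma D_anticommute:
  assumes "x \<in> fin_chains" "v < w"
  shows "D w (D v x) = - D v (D w x)"
proof -
  have "D w (D v x) = lin_ext (\<lambda>\<sigma>. D w (op v \<sigma>)) x"
    by (rule hom_lin_ext[OF lin_ext_hom])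
  also have "\<dots> = lin_ext (\<lambda>\<sigma>. - D v (op w \<sigma>)) x"
    using assms by (intro lin_ext_cong) (auto simp: fin_chains_def op_anticommute)
  also have "\<dots> = - D v (D w x)"
    by (simp only: lin_ext_uminus_fun hom_lin_ext[OF lin_ext_hom, of "op v" "op w" x])
  finally show ?thesis .
qed

text \<open>To reach its place in the increasing product, \<open>op v\<close> passes the factors below \<open>v\<close>, at the cost of one
  sign each; if \<open>v\<close> is already a factor, it meets it there and the product vanishes.\<close>

lemma D_mono_act:
  assumes "finite A" "x \<in> fin_chains"
  shows "D v (mono_act A x) =
    (if v \<in> A then 0 else scale ((-1) ^ card {a \<in> A. a < v}) (mono_act (insert v A) x))"
  using assms(1)
proof (induction A rule: finite_linorder_min_induct)
  case empty
  then show ?case using mono_act_insert_min[of "{}" v x] by (simp add: mono_act_empty)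
next
  case (insert b A)
  have act: "mono_act (insert b A) x = D b (mono_act A x)"
    using insert by (simp add: mono_act_insert_min)
  consider "v < b" | "v = b" | "b < v" by fastforce
  then show ?case
  proof cases
    case 1
    then have "\<And>a. a \<in> insert b A \<Longrightarrow> v < a" using insert by force
    moreover from this have "{a \<in> insert b A. a < v} = {}" "v \<notin> insert b A" by force+
    ultimately show ?thesis
      using insert by (simp add: mono_act_insert_min del: insert_iff Collect_empty_eq)
  next
    case 2
    then show ?thesis by (simp add: act D_square mono_act_fin assms(2))
  next
    case 3
    have "{a \<in> insert b A. a < v} = insert b {a \<in> A. a < v}" using 3 by auto
    moreover have "b \<notin> A" using insert by auto
    ultimately have card: "card {a \<in> insert b A. a < v} = Suc (card {a \<in> A. a < v})"
      using insert(1) by simp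
    have swap: "mono_act (insert v (insert b A)) x = D b (mono_act (insert v A) x)"
      using insert 3 by (subst insert_commute) (auto intro: mono_act_insert_min)
    have "D v (mono_act (insert b A) x) = - D b (D v (mono_act A x))"
      by (simp add: act D_anticommute 3 mono_act_fin assms(2))
    then show ?thesis
      unfolding card swap using 3 insert.IH
      by (simp add: lin_ext_scale del: insert_iff) auto
  qed
qed

text \<open>Induction on \<open>A\<close>, splitting off its smallest element \<open>b\<close>: as \<open>b\<close> lies below the rest of \<open>A\<close>, it
  passes only the elements of \<open>B\<close> below \<open>b\<close>, and these are the inversions that \<open>b\<close> adds.\<close>

lemma mono_act_mono_act:
  assumes "finite A" "finite B" "x \<in> fin_chains"
  shows "mono_act A (mono_act B x) =
    (if A \<inter> B = {} then scale ((-1) ^ card (inversions A B)) (mono_act (A \<union> B) x) else 0)"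
  using assms(1)
proof (induction A rule: finite_linorder_min_induct)
  case empty
  then show ?case by (simp add: mono_act_empty)
next
  case (insert b A)
  have act: "mono_act (insert b A) (mono_act B x) = D b (mono_act A (mono_act B x))"
    using insert by (simp add: mono_act_insert_min)
  show ?case
  proof (cases "A \<inter> B = {}")
    case False
    then show ?thesis using insert.IH by (auto simp: act)
  next
    case True
    have bA: "b \<notin> A" using insert by auto
    have below: "{c \<in> A \<union> B. c < b} = {c \<in> B. c < b}" using insert by force
    have "inversions (insert b A) B = inversions A B \<union> Pair b ` {c \<in> B. c < b}" by auto
    moreover have "inversions A B \<inter> Pair b ` {c \<in> B. c < b} = {}" using bA by auto
    ultimately have card: "card (inversions (insert b A) B) =
        card (inversions A B) + card {c \<in> B. c < b}"
      using insert(1) assms(2) by (simp add: card_Un_disjoint finite_inversions card_image inj_on_def)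
    have "D b (mono_act A (mono_act B x)) =
        scale ((-1) ^ card (inversions A B)) (D b (mono_act (A \<union> B) x))"
      using insert.IH True by (simp add: lin_ext_scale)
    also have "D b (mono_act (A \<union> B) x) = (if b \<in> B then 0 else
        scale ((-1) ^ card {c \<in> B. c < b}) (mono_act (insert b (A \<union> B)) x))"
      using D_mono_act[of "A \<union> B" x b] insert(1) assms(2,3) bA unfolding below by simp
    finally show ?thesis
      unfolding act card using True by (simp add: power_add)
  qed
qed

lemma ext_act_wedge:
  assumes "\<omega> \<in> ext_deg j" "\<eta> \<in> ext_deg k" "x \<in> fin_chains"
  shows "ext_act op (\<omega> \<and>\<^sub>e \<eta>) x = ext_act op \<omega> (ext_act op \<eta> x)"
  unfolding ext_act_mono_act ext_wedge_def hom_lin_ext[OF lin_ext_hom] hom_lin_ext[OF mono_act_hom]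
proof (intro lin_ext_cong)
  fix A B assume "A \<in> Poly_Mapping.keys \<omega>" "B \<in> Poly_Mapping.keys \<eta>"
  then have "finite A" "finite B"
    using assms by (auto simp: ext_deg_def)
  then show "lin_ext (\<lambda>A. mono_act A x)
       (if A \<inter> B = {} then Poly_Mapping.single (A \<union> B) ((-1) ^ card (inversions A B)) else 0) =
      mono_act A (mono_act B x)"
    by (simp add: mono_act_mono_act assms(3) lin_ext_monomial)
qed

text \<open>The family \<open>M\<close> will be the grading of the chains on a hypergraph that is closed under the operators.\<close>

lemma ext_act_graded:
  fixes M :: "int \<Rightarrow> ('v, 'r) chain set"
  assumes "\<And>n. chain.subspace (M n)"
    and "\<And>v n x. x \<in> M n \<Longrightarrow> D v x \<in> M (n + e)"
    and "\<omega> \<in> ext_deg k" "x \<in> M n"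
  shows "ext_act op \<omega> x \<in> M (n + e * int k)"
  unfolding ext_act_mono_act
proof (intro lin_ext_in_subspace assms(1))
  fix A assume "A \<in> Poly_Mapping.keys \<omega>"
  then have k: "k = length (sorted_list_of_set A)"
    using assms(3) by (auto simp: ext_deg_def)
  have "foldr D vs x \<in> M (n + e * int (length vs))" for vs
    using assms(4) by (induction vs) (auto dest: assms(2) simp: algebra_simps)
  then show "mono_act A x \<in> M (n + e * int k)"
    unfolding mono_act_def k .
qed

end


section \<open>Deletion and insertion of vertices\<close>

lemma single_fin: "finite \<sigma> \<Longrightarrow> Poly_Mapping.single \<sigma> c \<in> fin_chains"
  by (simp add: fin_chains_def)

lemma card_below_insert:
  "finite \<sigma> \<Longrightarrow> v < w \<Longrightarrow> v \<notin> \<sigma> \<Longrightarrow>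
    card {u \<in> insert v \<sigma>. u < w} = Suc (card {u \<in> \<sigma>. u < (w :: 'v::linorder)})"
proof -
  assume *: "finite \<sigma>" "v < w" "v \<notin> \<sigma>"
  then have "{u \<in> insert v \<sigma>. u < w} = insert v {u \<in> \<sigma>. u < w}" by auto
  then show ?thesis using * by simp
qed

text \<open>The bound \<open>3 \<le> card \<sigma>\<close> reflects that \<open>\<partial>/\<partial>v\<close> does not reach the empty set: an edge is killed by two
  deletions, in either order.\<close>

lemma del_op_twice:
  "finite \<sigma> \<Longrightarrow> lin_ext (del_op v) (del_op w \<sigma>) =
    (if v \<in> \<sigma> \<and> w \<in> \<sigma> \<and> v \<noteq> w \<and> 3 \<le> card \<sigma>
     then Poly_Mapping.single (\<sigma> - {v, w})
       ((-1) ^ card {u \<in> \<sigma>. u < w} * (-1) ^ card {u \<in> \<sigma> - {w}. u < v})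
     else (0 :: ('v::linorder, 'r::comm_ring_1) chain))"
  by (auto simp: del_op_def lin_ext_monomial scale_single Diff_insert2[symmetric] insert_commute)

lemma ins_op_twice:
  "lin_ext (ins_op v) (ins_op w \<sigma>) =
    (if v \<notin> \<sigma> \<and> w \<notin> \<sigma> \<and> v \<noteq> w
     then Poly_Mapping.single (insert v (insert w \<sigma>))
       ((-1) ^ card {u \<in> \<sigma>. u < w} * (-1) ^ card {u \<in> insert w \<sigma>. u < v})
     else (0 :: ('v::linorder, 'r::comm_ring_1) chain))"
  by (auto simp: ins_op_def lin_ext_monomial scale_single)

lemma anticommuting_del_op:
  "anticommuting (del_op :: 'v::linorder \<Rightarrow> 'v set \<Rightarrow> ('v, 'r::comm_ring_1) chain)"
proof
  fix \<sigma> :: "'v set" and v w :: 'v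
  assume fin: "finite \<sigma>"
  show "del_op v \<sigma> \<in> (fin_chains :: ('v, 'r) chain set)"
    using fin by (auto simp: del_op_def single_fin chain.subspace_0[OF fin_chains_subspace])
  show "lin_ext (del_op v) (del_op v \<sigma> :: ('v, 'r) chain) = 0"
    by (simp add: del_op_twice fin)
  assume "v < w"
  show "lin_ext (del_op w) (del_op v \<sigma>) = - lin_ext (del_op v) (del_op w \<sigma> :: ('v, 'r) chain)"
  proof (cases "v \<in> \<sigma> \<and> w \<in> \<sigma>")
    case True
    have "{u \<in> \<sigma> - {w}. u < v} = {u \<in> \<sigma>. u < v}" using \<open>v < w\<close> by auto
    moreover have "card {u \<in> \<sigma>. u < w} = Suc (card {u \<in> \<sigma> - {v}. u < w})"
      using card_below_insert[of "\<sigma> - {v}" v w] fin True \<open>v < w\<close> by (simp add: insert_absorb)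
    ultimately show ?thesis
      using True by (auto simp: del_op_twice fin insert_commute single_uminus mult.commute)
  qed (auto simp: del_op_twice fin)
qed

lemma anticommuting_ins_op:
  "anticommuting (ins_op :: 'v::linorder \<Rightarrow> 'v set \<Rightarrow> ('v, 'r::comm_ring_1) chain)"
proof
  fix \<sigma> :: "'v set" and v w :: 'v
  assume fin: "finite \<sigma>"
  show "ins_op v \<sigma> \<in> (fin_chains :: ('v, 'r) chain set)"
    using fin by (auto simp: ins_op_def single_fin chain.subspace_0[OF fin_chains_subspace])
  show "lin_ext (ins_op v) (ins_op v \<sigma> :: ('v, 'r) chain) = 0"
    by (simp add: ins_op_twice)
  assume "v < w"
  show "lin_ext (ins_op w) (ins_op v \<sigma>) = - lin_ext (ins_op v) (ins_op w \<sigma> :: ('v, 'r) chain)"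
  proof (cases "v \<notin> \<sigma> \<and> w \<notin> \<sigma>")
    case True
    have "{u \<in> insert w \<sigma>. u < v} = {u \<in> \<sigma>. u < v}" using \<open>v < w\<close> by auto
    moreover have "card {u \<in> insert v \<sigma>. u < w} = Suc (card {u \<in> \<sigma>. u < w})"
      using card_below_insert[of \<sigma> v w] fin True \<open>v < w\<close> by simp
    ultimately show ?thesis
      using True by (auto simp: ins_op_twice insert_commute single_uminus mult.commute)
  qed (auto simp: ins_op_twice)
qed

section \<open>Simplicial complexes and independence hypergraphs\<close>

definition simplicial_complex :: "'v set set \<Rightarrow> bool" where
  "simplicial_complex K \<longleftrightarrow> K \<subseteq> simplices \<and> (\<forall>\<sigma>\<in>K. \<forall>\<tau>. \<tau> \<noteq> {} \<and> \<tau> \<subseteq> \<sigma> \<longrightarrow> \<tau> \<in> K)"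

definition independence_hypergraph :: "'v set set \<Rightarrow> bool" where
  "independence_hypergraph L \<longleftrightarrow> L \<subseteq> simplices \<and> (\<forall>\<sigma>\<in>L. \<forall>\<tau>\<in>simplices. \<sigma> \<subseteq> \<tau> \<longrightarrow> \<tau> \<in> L)"

lemma del_op_free_mod:
  assumes "simplicial_complex K" "x \<in> free_mod n K"
  shows "lin_ext (del_op v) x \<in> free_mod (n + -1) K"
proof (intro lin_ext_in_subspace free_mod_subspace)
  fix \<sigma> assume "\<sigma> \<in> Poly_Mapping.keys x"
  then have *: "\<sigma> \<in> K" "int (card \<sigma>) = n + 1" using assms(2) by (auto simp: free_mod_def)
  show "del_op v \<sigma> \<in> free_mod (n + -1) K"
  proof (cases "v \<in> \<sigma> \<and> 2 \<le> card \<sigma>")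
    case True
    then have "card (\<sigma> - {v}) = card \<sigma> - 1" "card (\<sigma> - {v}) \<noteq> 0" by auto
    moreover from this have "\<sigma> - {v} \<in> K"
      using * assms(1) unfolding simplicial_complex_def
      by (metis Diff_subset card.empty)
    ultimately show ?thesis using * True by (auto simp: del_op_def free_mod_def)
  qed (auto simp: del_op_def chain.subspace_0[OF free_mod_subspace])
qed

lemma ins_op_free_mod:
  assumes "independence_hypergraph L" "x \<in> free_mod n L"
  shows "lin_ext (ins_op v) x \<in> free_mod (n + 1) L"
proof (intro lin_ext_in_subspace free_mod_subspace)
  fix \<sigma> assume "\<sigma> \<in> Poly_Mapping.keys x"
  then have *: "\<sigma> \<in> L" "int (card \<sigma>) = n + 1" using assms(2) by (auto simp: free_mod_def)
  moreover from * have "finite \<sigma>"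
    using assms(1) unfolding independence_hypergraph_def simplices_def by auto
  moreover from this * have "insert v \<sigma> \<in> L"
    using assms(1) unfolding independence_hypergraph_def simplices_def
    by (metis (mono_tags, lifting) finite.insertI insert_not_empty mem_Collect_eq subset_insertI)
  ultimately show "ins_op v \<sigma> \<in> free_mod (n + 1) L"
    by (auto simp: ins_op_def free_mod_def)
qed

lemma simplicial_complex_face:
  assumes "simplicial_complex K" "\<sigma> \<in> K" "\<tau> \<noteq> {}" "\<tau> \<subseteq> \<sigma>"
  shows "\<tau> \<in> K"
  using assms unfolding simplicial_complex_def by metis

lemma independence_hypergraph_coface:
  assumes "independence_hypergraph L" "\<sigma> \<in> L" "\<tau> \<in> simplices" "\<sigma> \<subseteq> \<tau>"
  shows "\<tau> \<in> L"
  using assms unfolding independence_hypergraph_def by metis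

lemma simplicial_complex_Int:
  assumes "simplicial_complex K" "simplicial_complex L"
  shows "simplicial_complex (K \<inter> L)"
  unfolding simplicial_complex_def
proof (intro conjI ballI allI impI)
  show "K \<inter> L \<subseteq> simplices" using assms by (auto simp: simplicial_complex_def)
  fix \<sigma> \<tau> assume "\<sigma> \<in> K \<inter> L" "\<tau> \<noteq> {} \<and> \<tau> \<subseteq> \<sigma>"
  then show "\<tau> \<in> K \<inter> L" using assms by (blast intro: simplicial_complex_face)
qed

lemma simplicial_complex_Un:
  assumes "simplicial_complex K" "simplicial_complex L"
  shows "simplicial_complex (K \<union> L)"
  unfolding simplicial_complex_def
proof (intro conjI ballI allI impI)
  show "K \<union> L \<subseteq> simplices" using assms by (auto simp: simplicial_complex_def)
  fix \<sigma> \<tau> assume "\<sigma> \<in> K \<union> L" "\<tau> \<noteq> {} \<and> \<tau> \<subseteq> \<sigma>"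
  then show "\<tau> \<in> K \<union> L" using assms by (blast intro: simplicial_complex_face)
qed

lemma independence_hypergraph_Int:
  assumes "independence_hypergraph K" "independence_hypergraph L"
  shows "independence_hypergraph (K \<inter> L)"
  unfolding independence_hypergraph_def
proof (intro conjI ballI impI)
  show "K \<inter> L \<subseteq> simplices" using assms by (auto simp: independence_hypergraph_def)
  fix \<sigma> \<tau> assume "\<sigma> \<in> K \<inter> L" "\<tau> \<in> simplices" "\<sigma> \<subseteq> \<tau>"
  then show "\<tau> \<in> K \<inter> L" using assms by (blast intro: independence_hypergraph_coface)
qed

lemma independence_hypergraph_Un:
  assumes "independence_hypergraph K" "independence_hypergraph L"
  shows "independence_hypergraph (K \<union> L)"
  unfolding independence_hypergraph_def
proof (intro conjI ballI impI)
  show "K \<union> L \<subseteq> simplices" using assms by (auto simp: independence_hypergraph_def)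
  fix \<sigma> \<tau> assume "\<sigma> \<in> K \<union> L" "\<tau> \<in> simplices" "\<sigma> \<subseteq> \<tau>"
  then show "\<tau> \<in> K \<union> L" using assms by (blast intro: independence_hypergraph_coface)
qed

lemma simplicial_hulls:
  assumes "hypergraph H"
  shows "simplicial_complex (\<delta> H)" "simplicial_complex (\<Delta> H)" "\<delta> H \<subseteq> \<Delta> H"
  using assms
  by (auto simp: hypergraph_def simplicial_complex_def simp_core_def simp_hull_def simplices_def
      dest: finite_subset)

lemma independence_hulls:
  assumes "hypergraph H"
  shows "independence_hypergraph (\<delta>bar H)" "independence_hypergraph (\<Delta>bar H)" "\<delta>bar H \<subseteq> \<Delta>bar H"
  using assms
  by (auto simp: hypergraph_def independence_hypergraph_def indep_core_def indep_hull_def)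

lemma hulls_mono:
  assumes "H \<subseteq> H'"
  shows "\<delta> H \<subseteq> \<delta> H'" "\<Delta> H \<subseteq> \<Delta> H'" "\<delta>bar H \<subseteq> \<delta>bar H'" "\<Delta>bar H \<subseteq> \<Delta>bar H'"
  using assms
  by (auto simp: simp_core_def simp_hull_def indep_core_def indep_hull_def)

section \<open>Naturality of the Mayer--Vietoris sequence\<close>

text \<open>Maps on homology are defined on cosets by ranging over all representatives. The result is the
  single coset of \<open>f z\<close> as soon as \<open>f\<close> maps boundaries to boundaries.\<close>

lemma coset_hom_image:
  assumes "chain_hom f" "chain.subspace B" "chain.subspace B'" "f ` B \<subseteq> B'"
  shows "{f x + b' | x b'. x \<in> {z + b | b. b \<in> B} \<and> b' \<in> B'} = {f z + b' | b'. b' \<in> B'}"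
proof (intro equalityI subsetI)
  fix y assume "y \<in> {f x + b' | x b'. x \<in> {z + b | b. b \<in> B} \<and> b' \<in> B'}"
  then obtain b b' where *: "b \<in> B" "b' \<in> B'" "y = f (z + b) + b'" by auto
  then have "y = f z + (f b + b')"
    by (simp add: module_hom.add[OF assms(1)] add.assoc)
  moreover have "f b + b' \<in> B'"
    using * assms(3,4) by (auto intro: chain.subspace_add)
  ultimately show "y \<in> {f z + b' | b'. b' \<in> B'}" by auto
next
  fix y assume "y \<in> {f z + b' | b'. b' \<in> B'}"
  moreover have "z \<in> {z + b | b. b \<in> B}"
    using chain.subspace_0[OF assms(2)] by force
  ultimately show "y \<in> {f x + b' | x b'. x \<in> {z + b | b. b \<in> B} \<and> b' \<in> B'}" by blast
qed

text \<open>A functorial family of complexes of chains on hypergraphs, with one differential \<open>d\<close> for all of them.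
  Assumptions \<open>term_Int\<close> and \<open>term_Un\<close> are the exactness of
  \<open>0 \<rightarrow> F (K \<inter> L) \<rightarrow> F K \<oplus> F L \<rightarrow> F (K \<union> L) \<rightarrow> 0\<close>. The predicate \<open>good\<close> will single out the simplicial
  complexes, or the independence hypergraphs: on other hypergraphs \<open>d\<close> may lead out of the chains.\<close>

locale hyp_complex =
  fixes good :: "'v set set \<Rightarrow> bool"
    and F :: "'v set set \<Rightarrow> ('v, 'r::comm_ring_1) chain cpx"
    and d :: "int \<Rightarrow> ('v, 'r) chain \<Rightarrow> ('v, 'r) chain"
    and dir :: int
  assumes good_Int: "good K \<Longrightarrow> good L \<Longrightarrow> good (K \<inter> L)"
    and good_Un: "good K \<Longrightarrow> good L \<Longrightarrow> good (K \<union> L)"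
    and cdir_F: "cdir (F K) = dir"
    and cdiff_F: "cdiff (F K) = d"
    and d_hom: "chain_hom (d n)"
    and term_subspace: "chain.subspace (cterm (F K) n)"
    and term_Int: "cterm (F (K \<inter> L)) n = cterm (F K) n \<inter> cterm (F L) n"
    and term_Un: "u \<in> cterm (F (K \<union> L)) n \<Longrightarrow>
      \<exists>y\<in>cterm (F K) n. \<exists>z\<in>cterm (F L) n. u = y - z"
    and d_term: "good K \<Longrightarrow> x \<in> cterm (F K) n \<Longrightarrow> d n x \<in> cterm (F K) (n + dir)"
    and d_d: "good K \<Longrightarrow> x \<in> cterm (F K) n \<Longrightarrow> d (n + dir) (d n x) = 0"
begin

lemmas d_diff = module_hom.diff[OF d_hom]

lemma term_mono: "K \<subseteq> L \<Longrightarrow> cterm (F K) n \<subseteq> cterm (F L) n"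
  using term_Int[of K L n] by (auto simp: inf.absorb1)

lemma boundaries_eq: "boundaries (F K) n = d (n - dir) ` cterm (F K) (n - dir)"
  by (simp add: boundaries_def cdiff_F cdir_F)

lemma boundaries_subspace: "chain.subspace (boundaries (F K) n)"
  unfolding boundaries_eq by (rule module_hom.subspace_image[OF d_hom term_subspace])

lemma boundaries_mono: "K \<subseteq> L \<Longrightarrow> boundaries (F K) n \<subseteq> boundaries (F L) n"
  unfolding boundaries_eq using term_mono by blast

lemma hclass_mem: "x \<in> hclass (F K) n z \<longleftrightarrow> x - z \<in> boundaries (F K) n"
proof -
  have "x = z + b \<longleftrightarrow> b = x - z" for b by auto
  then show ?thesis by (auto simp: hclass_def)
qed

lemma hclass_self: "z \<in> hclass (F K) n z"
  by (simp add: hclass_mem chain.subspace_0[OF boundaries_subspace])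

lemma homology_carrier: "carrier (homology (F K) n) = hclass (F K) n ` cycles (F K) n"
  by (simp add: homology_def)

lemma homology_add:
  "hclass (F K) n x \<oplus>\<^bsub>homology (F K) n\<^esub> hclass (F K) n y = hclass (F K) n (x + y)"
proof -
  have "{a + b | a b. a \<in> hclass (F K) n x \<and> b \<in> hclass (F K) n y} = hclass (F K) n (x + y)"
  proof (intro equalityI subsetI)
    fix c assume "c \<in> {a + b | a b. a \<in> hclass (F K) n x \<and> b \<in> hclass (F K) n y}"
    then obtain a b where ab: "a - x \<in> boundaries (F K) n" "b - y \<in> boundaries (F K) n" "c = a + b"
      by (auto simp: hclass_mem)
    then have "c - (x + y) = (a - x) + (b - y)" by simp
    then show "c \<in> hclass (F K) n (x + y)"
      unfolding hclass_mem using ab chain.subspace_add[OF boundaries_subspace] by metis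
  next
    fix c assume "c \<in> hclass (F K) n (x + y)"
    then have "c - y \<in> hclass (F K) n x" by (simp add: hclass_mem algebra_simps)
    then show "c \<in> {a + b | a b. a \<in> hclass (F K) n x \<and> b \<in> hclass (F K) n y}"
      using hclass_self[of y K n]
      by (intro CollectI exI[of _ "c - y"] exI[of _ y]) simp
  qed
  then show ?thesis by (simp add: homology_def)
qed

lemma homology_smult:
  "r \<odot>\<^bsub>homology (F K) n\<^esub> hclass (F K) n x = hclass (F K) n (scale r x)"
proof -
  have "scale r ` boundaries (F K) n \<subseteq> boundaries (F K) n"
    by (auto intro: chain.subspace_scale[OF boundaries_subspace])
  then show ?thesis
    using coset_hom_image[OF scale_hom boundaries_subspace boundaries_subspace]
    by (simp add: homology_def hclass_def)
qed

lemma hmap_id_hclass: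
  assumes "K \<subseteq> L"
  shows "hmap (F L) n id (hclass (F K) n z) = hclass (F L) n z"
  using coset_hom_image[OF chain_hom_id boundaries_subspace boundaries_subspace, of K n L n z]
    boundaries_mono[OF assms]
  by (simp add: hmap_def hclass_def)

lemma mvSU_hclass:
  "mvSU (mv F K L) n (hclass (F K) n y, hclass (F L) n z) = hclass (F (K \<union> L)) n (y - z)"
proof -
  let ?B = "boundaries (F (K \<union> L)) n"
  have "{y' - z' + w | y' z' w. y' \<in> hclass (F K) n y \<and> z' \<in> hclass (F L) n z \<and> w \<in> ?B} =
      hclass (F (K \<union> L)) n (y - z)"
  proof (intro equalityI subsetI)
    fix c
    assume "c \<in> {y' - z' + w | y' z' w. y' \<in> hclass (F K) n y \<and> z' \<in> hclass (F L) n z \<and> w \<in> ?B}"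
    then obtain y' z' w where "y' - y \<in> boundaries (F K) n" "z' - z \<in> boundaries (F L) n"
      and w: "w \<in> ?B" "c = y' - z' + w"
      unfolding hclass_mem by blast
    then have *: "y' - y \<in> ?B" "z' - z \<in> ?B"
      using boundaries_mono[of K "K \<union> L" n] boundaries_mono[of L "K \<union> L" n] by blast+
    have "c - (y - z) = ((y' - y) - (z' - z)) + w" using w by simp
    also have "\<dots> \<in> ?B"
      by (rule chain.subspace_add[OF boundaries_subspace
            chain.subspace_diff[OF boundaries_subspace *] w(1)])
    finally show "c \<in> hclass (F (K \<union> L)) n (y - z)" by (simp add: hclass_mem)
  next
    fix c assume "c \<in> hclass (F (K \<union> L)) n (y - z)"
    then show "c \<in> {y' - z' + w | y' z' w.
        y' \<in> hclass (F K) n y \<and> z' \<in> hclass (F L) n z \<and> w \<in> ?B}"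
      using hclass_self[of y K n] hclass_self[of z L n]
      by (intro CollectI exI[of _ y] exI[of _ z] exI[of _ "c - (y - z)"]) (simp add: hclass_mem)
  qed
  then show ?thesis by (simp add: mv_def)
qed

text \<open>The connecting homomorphism does not depend on choices. If \<open>y' - z'\<close> is homologous to \<open>y - z\<close>, split
  the chain \<open>v\<close> bounding the difference as \<open>v = p - q\<close>. Then \<open>y' - y - d p = z' - z - d q\<close> is a chain on
  both \<open>K\<close> and \<open>L\<close>, hence on \<open>K \<inter> L\<close>, and since \<open>d (d p) = 0\<close> its boundary is \<open>d y' - d y\<close>.\<close>

lemma mvUI_hclass:
  assumes "good K" "good L" "y \<in> cterm (F K) n" "z \<in> cterm (F L) n"
  shows "mvUI (mv F K L) n (hclass (F (K \<union> L)) n (y - z)) = hclass (F (K \<inter> L)) (n + dir) (d n y)"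
proof -
  let ?B = "boundaries (F (K \<inter> L)) (n + dir)"
  have "{d n y' + w | y' z' w. y' \<in> cterm (F K) n \<and> z' \<in> cterm (F L) n \<and>
        y' - z' \<in> hclass (F (K \<union> L)) n (y - z) \<and> w \<in> ?B} = hclass (F (K \<inter> L)) (n + dir) (d n y)"
  proof (intro equalityI subsetI)
    fix c
    assume "c \<in> {d n y' + w | y' z' w. y' \<in> cterm (F K) n \<and> z' \<in> cterm (F L) n \<and>
        y' - z' \<in> hclass (F (K \<union> L)) n (y - z) \<and> w \<in> ?B}"
    then obtain y' z' w where *: "y' \<in> cterm (F K) n" "z' \<in> cterm (F L) n"
      "y' - z' - (y - z) \<in> boundaries (F (K \<union> L)) n" "w \<in> ?B" "c = d n y' + w"
      by (auto simp: hclass_mem)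
    then obtain v where v: "v \<in> cterm (F (K \<union> L)) (n - dir)" "y' - z' - (y - z) = d (n - dir) v"
      by (auto simp: boundaries_eq)
    obtain p q where pq: "p \<in> cterm (F K) (n - dir)" "q \<in> cterm (F L) (n - dir)" "v = p - q"
      using term_Un[OF v(1)] by blast
    \<comment> \<open>the chain on \<open>K \<inter> L\<close> that makes \<open>d y'\<close> and \<open>d y\<close> homologous\<close>
    let ?g = "y' - y - d (n - dir) p"
    have eq: "?g = z' - z - d (n - dir) q"
      using v(2) unfolding pq(3) d_diff by (simp add: algebra_simps)
    have "?g \<in> cterm (F K) n"
      using * assms d_term[OF assms(1) pq(1)] by (auto intro!: chain.subspace_diff[OF term_subspace])
    moreover have "?g \<in> cterm (F L) n"
      unfolding eq
      using * assms d_term[OF assms(2) pq(2)] by (auto intro!: chain.subspace_diff[OF term_subspace])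
    ultimately have "d n ?g \<in> ?B"
      by (auto simp: boundaries_eq term_Int)
    moreover have "d n ?g = d n y' - d n y"
      using d_d[OF assms(1) pq(1)] by (simp add: d_diff)
    moreover have "c - d n y = (d n y' - d n y) + w" using * by simp
    ultimately show "c \<in> hclass (F (K \<inter> L)) (n + dir) (d n y)"
      unfolding hclass_mem using *(4) chain.subspace_add[OF boundaries_subspace] by metis
  next
    fix c assume "c \<in> hclass (F (K \<inter> L)) (n + dir) (d n y)"
    then have "c - d n y \<in> ?B" "c = d n y + (c - d n y)" by (simp_all add: hclass_mem)
    then show "c \<in> {d n y' + w | y' z' w. y' \<in> cterm (F K) n \<and> z' \<in> cterm (F L) n \<and>
        y' - z' \<in> hclass (F (K \<union> L)) n (y - z) \<and> w \<in> ?B}"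
      using assms(3,4) hclass_self[of "y - z" "K \<union> L" n] by blast
  qed
  then show ?thesis by (simp add: mv_def cdiff_F cdir_F)
qed

lemma cycles_UnE:
  assumes "u \<in> cycles (F (K \<union> L)) n"
  obtains y z where "y \<in> cterm (F K) n" "z \<in> cterm (F L) n" "u = y - z"
  using assms term_Un[of u K L n] by (auto simp: cycles_def cdiff_F)

end

lemma map_prod_mod_hom:
  assumes "h \<in> mod_hom M N" "k \<in> mod_hom M' N'"
  shows "map_prod h k \<in> mod_hom (dir_sum M M') (dir_sum N N')"
  using assms by (auto simp: mod_hom_def dir_sum_def)

locale natural_map =
  src: hyp_complex good F d dir + tgt: hyp_complex good G d' dir
  for good :: "'v set set \<Rightarrow> bool" and F G :: "'v set set \<Rightarrow> ('v, 'r::comm_ring_1) chain cpx"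
    and d d' dir +
  fixes f :: "('v, 'r) chain \<Rightarrow> ('v, 'r) chain"
  assumes f_hom: "chain_hom f"
    and f_term: "good K \<Longrightarrow> x \<in> cterm (F K) n \<Longrightarrow> f x \<in> cterm (G K) n"
    and f_d: "good K \<Longrightarrow> x \<in> cterm (F K) n \<Longrightarrow> f (d n x) = d' n (f x)"
begin

lemma f_cycles:
  assumes "good K" "K \<subseteq> L" "z \<in> cycles (F K) n"
  shows "f z \<in> cycles (G L) n"
proof -
  have "z \<in> cterm (F K) n" "d n z = 0"
    using assms(3) by (simp_all add: cycles_def src.cdiff_F)
  then show ?thesis
    using f_term[OF assms(1)] f_d[OF assms(1)] tgt.term_mono[OF assms(2)]
    by (fastforce simp: cycles_def tgt.cdiff_F module_hom.zero[OF f_hom])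
qed

lemma f_boundaries:
  assumes "good K" "K \<subseteq> L"
  shows "f ` boundaries (F K) n \<subseteq> boundaries (G L) n"
proof -
  have "f (d (n - dir) x) \<in> boundaries (G K) n" if "x \<in> cterm (F K) (n - dir)" for x
    using that f_term[OF assms(1)] f_d[OF assms(1)] by (auto simp: tgt.boundaries_eq)
  then show ?thesis
    using tgt.boundaries_mono[OF assms(2)] by (auto simp: src.boundaries_eq)
qed

lemma hmap_hclass:
  assumes "good K" "K \<subseteq> L"
  shows "hmap (G L) n f (hclass (F K) n z) = hclass (G L) n (f z)"
  using coset_hom_image[OF f_hom src.boundaries_subspace tgt.boundaries_subspace
      f_boundaries[OF assms]]
  by (simp add: hmap_def hclass_def)

lemma hmap_mod_hom:
  assumes "good K" "K \<subseteq> L"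
  shows "hmap (G L) n f \<in> mod_hom (homology (F K) n) (homology (G L) n)"
  unfolding mod_hom_def
  by (auto simp: src.homology_carrier tgt.homology_carrier hmap_hclass[OF assms] src.homology_add
      tgt.homology_add src.homology_smult tgt.homology_smult module_hom.add[OF f_hom]
      module_hom.scale[OF f_hom] intro: f_cycles[OF assms])

text \<open>Allowing larger hypergraphs in the target treats the maps induced by inclusions (\<open>f = id\<close>) together
  with those induced by operators. Each square of the ladder commutes on representatives; for the
  connecting map, \<open>f y - f z\<close> is a splitting of \<open>f u\<close> whenever \<open>y - z\<close> is one of \<open>u\<close>, so both ways around
  lead to the class of \<open>f (d y) = d' (f y)\<close>.\<close>

lemma mv_morphism_induced:
  assumes "good K" "good L" "K \<subseteq> K'" "L \<subseteq> L'" "good K'" "good L'"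
  shows "mv_morphism (mv F K L) (mv G K' L') (mv_induced f G K' L')"
proof -
  note good = assms(1,2,5,6) src.good_Int[OF assms(1,2)] src.good_Un[OF assms(1,2)]
  have sub: "K \<inter> L \<subseteq> K' \<inter> L'" "K \<union> L \<subseteq> K' \<union> L'" using assms by auto
  note hmap = hmap_hclass[OF \<open>good K\<close> \<open>K \<subseteq> K'\<close>] hmap_hclass[OF \<open>good L\<close> \<open>L \<subseteq> L'\<close>]
    hmap_hclass[OF good(5) sub(1)] hmap_hclass[OF good(6) sub(2)]
  have IS: "morS (mv_induced f G K' L') n (mvIS (mv F K L) n c) =
      mvIS (mv G K' L') n (morI (mv_induced f G K' L') n c)"
    if mem: "c \<in> carrier (mvI (mv F K L) n)" for n c
  proof -
    obtain z where c: "c = hclass (F (K \<inter> L)) n z"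
      using mem by (auto simp: mv_def src.homology_carrier)
    show ?thesis
      using src.hmap_id_hclass[of "K \<inter> L" K n z] src.hmap_id_hclass[of "K \<inter> L" L n z]
        tgt.hmap_id_hclass[of "K' \<inter> L'" K' n "f z"]
        tgt.hmap_id_hclass[of "K' \<inter> L'" L' n "f z"]
      by (simp add: c mv_def mv_induced_def hmap)
  qed
  have SU: "morU (mv_induced f G K' L') n (mvSU (mv F K L) n c) =
      mvSU (mv G K' L') n (morS (mv_induced f G K' L') n c)"
    if mem: "c \<in> carrier (mvS (mv F K L) n)" for n c
  proof -
    obtain y z where "c = (hclass (F K) n y, hclass (F L) n z)"
      using mem by (auto simp: mv_def dir_sum_def src.homology_carrier)
    then show ?thesis
      by (simp add: src.mvSU_hclass mv_induced_def hmap tgt.mvSU_hclass module_hom.diff[OF f_hom])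
  qed
  have UI: "morI (mv_induced f G K' L') (n + dir) (mvUI (mv F K L) n c) =
      mvUI (mv G K' L') n (morU (mv_induced f G K' L') n c)"
    if mem: "c \<in> carrier (mvU (mv F K L) n)" for n c
  proof -
    obtain u where u: "u \<in> cycles (F (K \<union> L)) n" and c: "c = hclass (F (K \<union> L)) n u"
      using mem by (auto simp: mv_def src.homology_carrier)
    obtain y z where yz: "y \<in> cterm (F K) n" "z \<in> cterm (F L) n" "u = y - z"
      using src.cycles_UnE[OF u] by blast
    have "f y \<in> cterm (G K') n" "f z \<in> cterm (G L') n"
      using f_term[OF \<open>good K\<close> yz(1)] f_term[OF \<open>good L\<close> yz(2)] tgt.term_mono assms(3,4) by blast+
    then show ?thesis
      using yz(1,2)
      by (simp add: c yz(3) src.mvUI_hclass good mv_induced_def hmap tgt.mvUI_hclass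
          module_hom.diff[OF f_hom] f_d[OF \<open>good K\<close>])
  qed
  have "mvdir (mv F K L) = dir" "mvdir (mv G K' L') = dir"
    by (simp_all add: mv_def src.cdir_F tgt.cdir_F)
  moreover have "morI (mv_induced f G K' L') n \<in> mod_hom (mvI (mv F K L) n) (mvI (mv G K' L') n)"
    "morS (mv_induced f G K' L') n \<in> mod_hom (mvS (mv F K L) n) (mvS (mv G K' L') n)"
    "morU (mv_induced f G K' L') n \<in> mod_hom (mvU (mv F K L) n) (mvU (mv G K' L') n)" for n
    using good sub assms(3,4)
    by (simp_all add: mv_def mv_induced_def hmap_mod_hom map_prod_mod_hom)
  ultimately show ?thesis
    unfolding mv_morphism_def using IS SU UI by metis
qed

end

lemma natural_map_id:
  assumes "hyp_complex good F d dir"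
  shows "natural_map good F F d d dir id"
  using assms by (simp add: natural_map_def natural_map_axioms_def chain_hom_id)

text \<open>Serves for multiplicativity, and with \<open>g = id\<close> or \<open>f = id\<close> for compatibility with inclusions: both
  sides send the class of \<open>z\<close> to the class of \<open>h z = f (g z)\<close>.\<close>

lemma mv_eq_compose:
  assumes h: "natural_map good F E d d'' dir h"
    and g: "natural_map good F G d d' dir g" and f: "natural_map good G E d' d'' dir f"
    and good: "good K" "good L" "good K'" "good L'"
    and sub: "K \<subseteq> K'" "L \<subseteq> L'" "K' \<subseteq> K''" "L' \<subseteq> L''"
    and eq: "\<And>X n x. good X \<Longrightarrow> x \<in> cterm (F X) n \<Longrightarrow> h x = f (g x)"
  shows "mv_eq (mv F K L) (mv_induced h E K'' L'')
    (mv_comp (mv_induced f E K'' L'') (mv_induced g G K' L'))"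
proof -
  interpret h: natural_map good F E d d'' dir h by (rule h)
  interpret g: natural_map good F G d d' dir g by (rule g)
  interpret f: natural_map good G E d' d'' dir f by (rule f)
  have hmap: "hmap (E X'') n h c = hmap (E X'') n f (hmap (G X') n g c)"
    if "good X" "good X'" "X \<subseteq> X'" "X' \<subseteq> X''" and mem: "c \<in> carrier (homology (F X) n)" for X X' X'' n c
  proof -
    obtain z where z: "z \<in> cycles (F X) n" "c = hclass (F X) n z"
      using mem by (auto simp: h.src.homology_carrier)
    then have "h z = f (g z)" using eq[OF that(1)] by (auto simp: cycles_def)
    then show ?thesis
      using that by (simp add: z(2) h.hmap_hclass g.hmap_hclass f.hmap_hclass)
  qed
  have "K \<inter> L \<subseteq> K' \<inter> L'" "K' \<inter> L' \<subseteq> K'' \<inter> L''" "K \<union> L \<subseteq> K' \<union> L'" "K' \<union> L' \<subseteq> K'' \<union> L''"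
    using sub by auto
  note int = hmap[OF h.src.good_Int[OF good(1,2)] h.src.good_Int[OF good(3,4)] this(1,2)]
    and un = hmap[OF h.src.good_Un[OF good(1,2)] h.src.good_Un[OF good(3,4)] this(3,4)]
  show ?thesis
    using int un hmap[OF good(1,3) sub(1,3)] hmap[OF good(2,4) sub(2,4)]
    by (simp add: mv_eq_def mv_def mv_induced_def mv_comp_def dir_sum_def)
qed

lemma mv_eq_sym: "mv_eq M \<phi> \<psi> \<Longrightarrow> mv_eq M \<psi> \<phi>"
  by (simp add: mv_eq_def)

lemma mv_eq_trans: "mv_eq M \<phi> \<psi> \<Longrightarrow> mv_eq M \<psi> \<chi> \<Longrightarrow> mv_eq M \<phi> \<chi>"
  by (simp add: mv_eq_def)

section \<open>Persistence\<close>

text \<open>What persistence needs of \<open>\<delta>\<close> and \<open>\<Delta>\<close>, and of their independence versions: they are functorial, and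
  the core is contained in the hull.\<close>

locale hull_pair =
  fixes good :: "'v set set \<Rightarrow> bool" and cor clo :: "'v set set \<Rightarrow> 'v set set"
  assumes good_cor: "hypergraph X \<Longrightarrow> good (cor X)"
    and good_clo: "hypergraph X \<Longrightarrow> good (clo X)"
    and cor_mono: "X \<subseteq> Y \<Longrightarrow> cor X \<subseteq> cor Y"
    and clo_mono: "X \<subseteq> Y \<Longrightarrow> clo X \<subseteq> clo Y"
    and cor_clo: "hypergraph X \<Longrightarrow> cor X \<subseteq> clo X"
begin

lemma pmv_morphism_induced:
  assumes nat: "natural_map good F G d d' dir f"
    and filt: "hyp_filtration H" "hyp_filtration H'"
  shows "pmv_morphism (pmv F cor clo H H') (pmv G cor clo H H') (pmv_induced f G cor clo H H')"
proof -
  interpret natural_map good F G d d' dir f by (rule nat)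
  note idF = natural_map_id[OF src.hyp_complex_axioms]
  note idG = natural_map_id[OF tgt.hyp_complex_axioms]
  \<comment> \<open>both composites equal the morphism induced by \<open>f\<close> from \<open>K, L\<close> to \<open>K', L'\<close>\<close>
  have square: "mv_eq (mv F K L) (mv_comp (mv_induced f G K' L') (mv_induced id F K' L'))
      (mv_comp (mv_induced id G K' L') (mv_induced f G K L))"
    if "good K" "good L" "good K'" "good L'" "K \<subseteq> K'" "L \<subseteq> L'" for K L K' L'
    using mv_eq_compose[OF nat idF nat that order_refl order_refl]
      mv_eq_compose[OF nat nat idG that(1,2,1,2) order_refl order_refl that(5,6)]
    by (auto intro: mv_eq_trans mv_eq_sym)
  have "hypergraph (H x)" "hypergraph (H' x)" for x
    using filt by (simp_all add: hyp_filtration_def)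
  moreover have mono: "H x \<subseteq> H y" "H' x \<subseteq> H' y" if "x \<le> y" for x y
    using filt that by (simp_all add: hyp_filtration_def)
  ultimately show ?thesis
    by (auto simp: pmv_morphism_def pmv_def pmv_induced_def good_cor good_clo
        intro!: square mv_morphism_induced cor_mono clo_mono cor_clo mono)
qed

lemma pmv_eq_compose:
  assumes "natural_map good F E d d'' dir h"
    "natural_map good F G d d' dir g" "natural_map good G E d' d'' dir f"
    and "\<And>X n x. good X \<Longrightarrow> x \<in> cterm (F X) n \<Longrightarrow> h x = f (g x)"
    and "hyp_filtration H" "hyp_filtration H'"
  shows "pmv_eq (pmv F cor clo H H') (pmv_induced h E cor clo H H')
    (pmv_comp (pmv_induced f E cor clo H H') (pmv_induced g G cor clo H H'))"
  using assms(5,6)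
  by (auto simp: pmv_eq_def pmv_def pmv_induced_def pmv_comp_def hyp_filtration_def
      good_cor good_clo intro!: mv_eq_compose[OF assms(1-3) _ _ _ _ _ _ _ _ assms(4)])

end

section \<open>Constrained complexes\<close>

text \<open>With \<open>m = \<lambda> (2t + 1) + q\<close>, the dimension \<open>(n + \<lambda>) (2t + 1) + q\<close> is \<open>n (2t + 1) + m\<close>: division with
  remainder disappears, and a change of \<open>m\<close> shifts all dimensions equally.\<close>

lemma constr_term_eq:
  "constr_term t m K n = (if 0 \<le> n then free_mod (n * (2 * int t + 1) + m) K else {0})"
proof -
  have "(n + m div p) * p + m mod p = n * p + m" for p
    by (simp add: distrib_right add.assoc)
  then show ?thesis by (simp add: constr_term_def Let_def)
qed

lemma constr_term_subspace: "chain.subspace (constr_term t m K n)"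
  by (simp add: constr_term_eq free_mod_subspace)

lemma free_mod_Un:
  assumes "u \<in> free_mod n (K \<union> L)"
  shows "\<exists>y\<in>free_mod n K. \<exists>z\<in>free_mod n L. u = y - z"
proof -
  \<comment> \<open>\<open>y\<close> is the restriction of \<open>u\<close> to the simplices in \<open>K\<close>\<close>
  define y where "y = lin_ext (\<lambda>\<sigma>. if \<sigma> \<in> K then Poly_Mapping.single \<sigma> 1 else 0) u"
  have lookup_y: "Poly_Mapping.lookup y \<sigma> = (if \<sigma> \<in> K then Poly_Mapping.lookup u \<sigma> else 0)" for \<sigma>
  proof -
    have "Poly_Mapping.lookup y \<sigma> = (\<Sum>\<tau>\<in>Poly_Mapping.keys u.
        if \<tau> = \<sigma> then (if \<sigma> \<in> K then Poly_Mapping.lookup u \<sigma> else 0) else 0)"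
      unfolding y_def lin_ext_def lookup_sum
      by (intro sum.cong) (auto simp: lookup_scale lookup_single when_def)
    then show ?thesis by (simp add: in_keys_iff)
  qed
  have "y \<in> free_mod n K" "y - u \<in> free_mod n L"
    using assms by (auto simp: free_mod_def in_keys_iff lookup_y lookup_minus split: if_splits)
  then show ?thesis by (intro bexI[of _ y] bexI[of _ "y - u"]) auto
qed

lemma constr_term_Un:
  assumes "u \<in> constr_term t m (K \<union> L) n"
  shows "\<exists>y\<in>constr_term t m K n. \<exists>z\<in>constr_term t m L n. u = y - z"
  using assms free_mod_Un[of u _ K L] by (auto simp: constr_term_eq split: if_splits)

lemma constr_term_Int:
  "constr_term t m (K \<inter> L) n = constr_term t m K n \<inter> constr_term t m L n"
  by (auto simp: constr_term_eq free_mod_def)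

text \<open>Common form of the two actions. Each operator changes the dimension by \<open>e\<close>, which is \<open>-1\<close> for deletion
  and \<open>1\<close> for insertion; \<open>e\<close> is also the direction of the differential. Degree \<open>n0\<close> is the lowest in which
  the differential is the action of the algebra element and not set to \<open>0\<close>; from there on, both source
  and target lie in non-negative degrees, where no term is truncated.\<close>

locale ext_action =
  anticommuting op + hull_pair good cor clo
  for op :: "'v::linorder \<Rightarrow> 'v set \<Rightarrow> ('v, 'r::comm_ring_1) chain"
    and good :: "'v set set \<Rightarrow> bool" and cor clo +
  fixes e n0 :: int
  assumes good_Int: "good K \<Longrightarrow> good L \<Longrightarrow> good (K \<inter> L)"
    and good_Un: "good K \<Longrightarrow> good L \<Longrightarrow> good (K \<union> L)"
    and good_simplices: "good K \<Longrightarrow> K \<subseteq> simplices"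
    and op_free_mod: "good K \<Longrightarrow> x \<in> free_mod n K \<Longrightarrow> D v x \<in> free_mod (n + e) K"
    and n0_nonneg: "0 \<le> n0" "0 \<le> n0 + e"
begin

definition constr_diff :: "('v, 'r) ext \<Rightarrow> int \<Rightarrow> ('v, 'r) chain \<Rightarrow> ('v, 'r) chain" where
  "constr_diff \<omega> n x = (if n0 \<le> n then ext_act op \<omega> x else 0)"

definition constr_cpx :: "nat \<Rightarrow> ('v, 'r) ext \<Rightarrow> int \<Rightarrow> 'v set set \<Rightarrow> ('v, 'r) chain cpx" where
  "constr_cpx t \<omega> m K = \<lparr>cterm = constr_term t m K, cdiff = constr_diff \<omega>, cdir = e\<rparr>"

lemma constr_term_fin: "good K \<Longrightarrow> x \<in> constr_term t m K n \<Longrightarrow> x \<in> fin_chains"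
  using good_simplices[of K]
  by (auto simp: constr_term_eq free_mod_def fin_chains_def simplices_def split: if_splits)

lemma ext_act_free_mod:
  "good K \<Longrightarrow> \<omega> \<in> ext_deg k \<Longrightarrow> x \<in> free_mod n K \<Longrightarrow> ext_act op \<omega> x \<in> free_mod (n + e * int k) K"
  by (rule ext_act_graded[of "\<lambda>n. free_mod n K"]) (auto simp: free_mod_subspace op_free_mod)

lemma ext_act_zero: "ext_act op \<omega> 0 = 0"
  by (rule module_hom.zero[OF ext_act_hom])

text \<open>The degree \<open>2t + 1\<close> of \<open>\<omega>\<close> is used twice: it is the distance of consecutive dimensions in the complex,
  and it is odd, so that \<open>\<omega> \<and> \<omega> = 0\<close>.\<close>

lemma hyp_complex_constr:
  assumes "(2 :: 'r) dvd 1" "\<omega> \<in> ext_deg (2 * t + 1)"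
  shows "hyp_complex good (constr_cpx t \<omega> m) (constr_diff \<omega>) e"
proof (rule hyp_complex.intro)
  fix K L and n :: int and x u :: "('v, 'r) chain"
  show "chain_hom (constr_diff \<omega> n)"
    by (rule chain_homI)
      (simp_all add: constr_diff_def module_hom.add[OF ext_act_hom] module_hom.scale[OF ext_act_hom])
  show "u \<in> cterm (constr_cpx t \<omega> m (K \<union> L)) n \<Longrightarrow>
      \<exists>y\<in>cterm (constr_cpx t \<omega> m K) n. \<exists>z\<in>cterm (constr_cpx t \<omega> m L) n. u = y - z"
    by (simp add: constr_cpx_def constr_term_Un)
  assume good: "good K" and "x \<in> cterm (constr_cpx t \<omega> m K) n"
  then have x: "x \<in> constr_term t m K n" by (simp add: constr_cpx_def)
  show "constr_diff \<omega> n x \<in> cterm (constr_cpx t \<omega> m K) (n + e)"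
  proof (cases "n0 \<le> n")
    case True
    then have "0 \<le> n" "0 \<le> n + e" using n0_nonneg by auto
    moreover have shift: "n * (2 * int t + 1) + m + e * int (2 * t + 1) =
        (n + e) * (2 * int t + 1) + m"
      by (simp add: algebra_simps)
    ultimately show ?thesis
      using True x ext_act_free_mod[OF good assms(2), of x "n * (2 * int t + 1) + m", unfolded shift]
      by (simp add: constr_cpx_def constr_diff_def constr_term_eq)
  qed (simp add: constr_diff_def constr_cpx_def chain.subspace_0[OF constr_term_subspace])
  have "ext_act op \<omega> (ext_act op \<omega> x) = 0"
    using ext_act_wedge[OF assms(2,2) constr_term_fin[OF good x]]
      ext_wedge_odd_square[OF assms(2) _ assms(1)] by (simp add: ext_act_mono_act)
  then show "constr_diff \<omega> (n + e) (constr_diff \<omega> n x) = 0"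
    by (simp add: constr_diff_def ext_act_zero)
qed (simp_all add: constr_cpx_def constr_term_subspace constr_term_Int good_Int good_Un)

lemma ext_act_even_commute:
  assumes "\<beta> \<in> ext_deg j" "even j" "\<omega> \<in> ext_deg k" "x \<in> fin_chains"
  shows "ext_act op \<beta> (ext_act op \<omega> x) = ext_act op \<omega> (ext_act op \<beta> x)"
  using ext_wedge_even_commute[OF assms(1,3,2)] assms by (metis ext_act_wedge)

text \<open>Degree \<open>2s\<close> shifts every dimension by \<open>2 e s\<close>, which is the shift from \<open>m\<close> to \<open>m'\<close>; as it is even, the
  action commutes with the differential.\<close>

lemma natural_map_ext_act:
  assumes two: "(2 :: 'r) dvd 1" and \<omega>: "\<omega> \<in> ext_deg (2 * t + 1)" and \<beta>: "\<beta> \<in> ext_deg (2 * s)"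
    and m': "m' = m + e * (2 * int s)"
  shows "natural_map good (constr_cpx t \<omega> m) (constr_cpx t \<omega> m') (constr_diff \<omega>) (constr_diff \<omega>) e
    (ext_act op \<beta>)"
proof (intro natural_map.intro hyp_complex_constr natural_map_axioms.intro ext_act_hom two \<omega>)
  fix K x and n :: int
  assume good: "good K" and "x \<in> cterm (constr_cpx t \<omega> m K) n"
  then have x: "x \<in> constr_term t m K n" by (simp add: constr_cpx_def)
  have shift: "n * (2 * int t + 1) + m + e * int (2 * s) = n * (2 * int t + 1) + m'"
    by (simp add: m')
  show "ext_act op \<beta> x \<in> cterm (constr_cpx t \<omega> m' K) n"
    using x ext_act_free_mod[OF good \<beta>, of x "n * (2 * int t + 1) + m", unfolded shift]
    by (auto simp: constr_cpx_def constr_term_eq ext_act_zero split: if_splits)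
  show "ext_act op \<beta> (constr_diff \<omega> n x) = constr_diff \<omega> n (ext_act op \<beta> x)"
    using ext_act_even_commute[OF \<beta> _ \<omega> constr_term_fin[OF good x]]
    by (simp add: constr_diff_def ext_act_zero)
qed

abbreviation PMV where "PMV t H H' \<omega> m \<equiv> pmv (constr_cpx t \<omega> m) cor clo H H'"

abbreviation star where
  "star t H H' \<omega> m \<beta> \<equiv> pmv_induced (ext_act op \<beta>) (constr_cpx t \<omega> m) cor clo H H'"

theorem star_morphism:
  assumes "(2 :: 'r) dvd 1" "\<omega> \<in> ext_deg (2 * t + 1)" "\<beta> \<in> ext_deg (2 * s)"
    "hyp_filtration H" "hyp_filtration H'" "m' = m + e * (2 * int s)"
  shows "pmv_morphism (PMV t H H' \<omega> m) (PMV t H H' \<omega> m') (star t H H' \<omega> m' \<beta>)"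
  using pmv_morphism_induced[OF natural_map_ext_act] assms by blast

text \<open>The two composites run through different intermediate complexes, with parameters \<open>m2\<close> and \<open>m1\<close>. The
  first agrees with the product by multiplicativity of the action, the second by even commutation.\<close>

theorem star_wedge:
  assumes two: "(2 :: 'r) dvd 1" and \<omega>: "\<omega> \<in> ext_deg (2 * t + 1)"
    and \<beta>1: "\<beta>1 \<in> ext_deg (2 * s1)" and \<beta>2: "\<beta>2 \<in> ext_deg (2 * s2)"
    and filt: "hyp_filtration H" "hyp_filtration H'"
    and m1: "m1 = m + e * (2 * int s1)" and m2: "m2 = m + e * (2 * int s2)"
    and m12: "m12 = m + e * (2 * int s1) + e * (2 * int s2)"
  shows "pmv_morphism (PMV t H H' \<omega> m) (PMV t H H' \<omega> m12) (star t H H' \<omega> m12 (\<beta>1 \<and>\<^sub>e \<beta>2))"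
    and "pmv_eq (PMV t H H' \<omega> m) (star t H H' \<omega> m12 (\<beta>1 \<and>\<^sub>e \<beta>2))
      (pmv_comp (star t H H' \<omega> m12 \<beta>1) (star t H H' \<omega> m2 \<beta>2))"
    and "pmv_eq (PMV t H H' \<omega> m) (star t H H' \<omega> m12 (\<beta>1 \<and>\<^sub>e \<beta>2))
      (pmv_comp (star t H H' \<omega> m12 \<beta>2) (star t H H' \<omega> m1 \<beta>1))"
proof -
  have \<beta>12: "\<beta>1 \<and>\<^sub>e \<beta>2 \<in> ext_deg (2 * (s1 + s2))"
    using ext_wedge_deg[OF \<beta>1 \<beta>2] by simp
  have shift: "m12 = m + e * (2 * int (s1 + s2))" "m12 = m2 + e * (2 * int s1)"
    "m12 = m1 + e * (2 * int s2)"
    by (simp_all add: m1 m2 m12 algebra_simps)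
  note nat = natural_map_ext_act[OF two \<omega>]
  show "pmv_morphism (PMV t H H' \<omega> m) (PMV t H H' \<omega> m12) (star t H H' \<omega> m12 (\<beta>1 \<and>\<^sub>e \<beta>2))"
    by (rule pmv_morphism_induced[OF nat[OF \<beta>12 shift(1)] filt])
  show "pmv_eq (PMV t H H' \<omega> m) (star t H H' \<omega> m12 (\<beta>1 \<and>\<^sub>e \<beta>2))
      (pmv_comp (star t H H' \<omega> m12 \<beta>1) (star t H H' \<omega> m2 \<beta>2))"
  proof (rule pmv_eq_compose[OF nat[OF \<beta>12 shift(1)] nat[OF \<beta>2 m2] nat[OF \<beta>1 shift(2)] _ filt])
    fix X n x assume "good X" "x \<in> cterm (constr_cpx t \<omega> m X) n"
    then have "x \<in> fin_chains" by (simp add: constr_cpx_def constr_term_fin)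
    then show "ext_act op (\<beta>1 \<and>\<^sub>e \<beta>2) x = ext_act op \<beta>1 (ext_act op \<beta>2 x)"
      by (rule ext_act_wedge[OF \<beta>1 \<beta>2])
  qed
  show "pmv_eq (PMV t H H' \<omega> m) (star t H H' \<omega> m12 (\<beta>1 \<and>\<^sub>e \<beta>2))
      (pmv_comp (star t H H' \<omega> m12 \<beta>2) (star t H H' \<omega> m1 \<beta>1))"
  proof (rule pmv_eq_compose[OF nat[OF \<beta>12 shift(1)] nat[OF \<beta>1 m1] nat[OF \<beta>2 shift(3)] _ filt])
    fix X n x assume "good X" "x \<in> cterm (constr_cpx t \<omega> m X) n"
    then have "x \<in> fin_chains" by (simp add: constr_cpx_def constr_term_fin)
    then show "ext_act op (\<beta>1 \<and>\<^sub>e \<beta>2) x = ext_act op \<beta>2 (ext_act op \<beta>1 x)"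
      using ext_act_wedge[OF \<beta>1 \<beta>2] ext_act_even_commute[OF \<beta>1 _ \<beta>2] by simp
  qed
qed

end

lemma ext_action_del_op:
  "ext_action (del_op :: 'v::linorder \<Rightarrow> 'v set \<Rightarrow> ('v, 'r::comm_ring_1) chain)
    simplicial_complex \<delta> \<Delta> (-1) 1"
  by (intro ext_action.intro hull_pair.intro ext_action_axioms.intro anticommuting_del_op
      simplicial_hulls simplicial_complex_Int simplicial_complex_Un del_op_free_mod)
    (auto simp: hulls_mono simplicial_complex_def)

lemma ext_action_ins_op:
  "ext_action (ins_op :: 'v::linorder \<Rightarrow> 'v set \<Rightarrow> ('v, 'r::comm_ring_1) chain)
    independence_hypergraph \<delta>bar \<Delta>bar 1 0"
  by (intro ext_action.intro hull_pair.intro ext_action_axioms.intro anticommuting_ins_op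
      independence_hulls independence_hypergraph_Int independence_hypergraph_Un ins_op_free_mod)
    (auto simp: hulls_mono independence_hypergraph_def)

theorem theorem5p1:
  fixes t s s1 s2 :: nat
    and m :: int
    and \<alpha> \<beta> \<beta>1 \<beta>2 \<omega> \<mu> \<mu>1 \<mu>2 :: "('v::linorder, 'r::idom) ext"
    and H H' :: "real \<Rightarrow> 'v set set"
  assumes two_invertible: "(2 :: 'r) dvd 1"
    and "\<alpha> \<in> ext_deg (2 * t + 1)" and "\<omega> \<in> ext_deg (2 * t + 1)"
    and "\<beta> \<in> ext_deg (2 * s)" and "\<beta>1 \<in> ext_deg (2 * s1)" and "\<beta>2 \<in> ext_deg (2 * s2)"
    and "\<mu> \<in> ext_deg (2 * s)" and "\<mu>1 \<in> ext_deg (2 * s1)" and "\<mu>2 \<in> ext_deg (2 * s2)"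
    and "hyp_filtration H" and "hyp_filtration H'"
  shows
    "(pmv_morphism (PMV_low t H H' \<alpha> m) (PMV_low t H H' \<alpha> (m - 2 * int s))
        (low_star t H H' \<alpha> (m - 2 * int s) \<beta>) \<and>
      pmv_morphism (PMV_low t H H' \<alpha> m) (PMV_low t H H' \<alpha> (m - 2 * int s1 - 2 * int s2))
        (low_star t H H' \<alpha> (m - 2 * int s1 - 2 * int s2) (\<beta>1 \<and>\<^sub>e \<beta>2)) \<and>
      pmv_eq (PMV_low t H H' \<alpha> m)
        (low_star t H H' \<alpha> (m - 2 * int s1 - 2 * int s2) (\<beta>1 \<and>\<^sub>e \<beta>2))
        (pmv_comp (low_star t H H' \<alpha> (m - 2 * int s1 - 2 * int s2) \<beta>1)
                  (low_star t H H' \<alpha> (m - 2 * int s2) \<beta>2)) \<and>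
      pmv_eq (PMV_low t H H' \<alpha> m)
        (low_star t H H' \<alpha> (m - 2 * int s1 - 2 * int s2) (\<beta>1 \<and>\<^sub>e \<beta>2))
        (pmv_comp (low_star t H H' \<alpha> (m - 2 * int s1 - 2 * int s2) \<beta>2)
                  (low_star t H H' \<alpha> (m - 2 * int s1) \<beta>1)))
     \<and>
     (pmv_morphism (PMV_up t H H' \<omega> m) (PMV_up t H H' \<omega> (m + 2 * int s))
        (up_star t H H' \<omega> (m + 2 * int s) \<mu>) \<and>
      pmv_morphism (PMV_up t H H' \<omega> m) (PMV_up t H H' \<omega> (m + 2 * int s1 + 2 * int s2))
        (up_star t H H' \<omega> (m + 2 * int s1 + 2 * int s2) (\<mu>1 \<and>\<^sub>e \<mu>2)) \<and>
      pmv_eq (PMV_up t H H' \<omega> m)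
        (up_star t H H' \<omega> (m + 2 * int s1 + 2 * int s2) (\<mu>1 \<and>\<^sub>e \<mu>2))
        (pmv_comp (up_star t H H' \<omega> (m + 2 * int s1 + 2 * int s2) \<mu>1)
                  (up_star t H H' \<omega> (m + 2 * int s2) \<mu>2)) \<and>
      pmv_eq (PMV_up t H H' \<omega> m)
        (up_star t H H' \<omega> (m + 2 * int s1 + 2 * int s2) (\<mu>1 \<and>\<^sub>e \<mu>2))
        (pmv_comp (up_star t H H' \<omega> (m + 2 * int s1 + 2 * int s2) \<mu>2)
                  (up_star t H H' \<omega> (m + 2 * int s1) \<mu>1)))"
proof -
  interpret low: ext_action "del_op :: 'v \<Rightarrow> 'v set \<Rightarrow> ('v, 'r) chain" simplicial_complex \<delta> \<Delta> "-1" 1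
    by (rule ext_action_del_op)
  interpret up: ext_action "ins_op :: 'v \<Rightarrow> 'v set \<Rightarrow> ('v, 'r) chain"
    independence_hypergraph \<delta>bar \<Delta>bar 1 0
    by (rule ext_action_ins_op)
  have low_cpx: "chain_cpx = (low.constr_cpx :: nat \<Rightarrow> ('v, 'r) ext \<Rightarrow> _)"
    by (intro ext) (simp add: chain_cpx_def low.constr_cpx_def low.constr_diff_def fun_eq_iff)
  have up_cpx: "cochain_cpx = (up.constr_cpx :: nat \<Rightarrow> ('v, 'r) ext \<Rightarrow> _)"
    by (intro ext) (simp add: cochain_cpx_def up.constr_cpx_def up.constr_diff_def fun_eq_iff)
  note defs = PMV_low_def PMV_up_def low_star_def up_star_def low_cpx up_cpx
  show ?thesis
    unfolding defs
    by (intro conjI low.star_morphism[where s = s] low.star_wedge[where ?s1.0 = s1 and ?s2.0 = s2]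
        up.star_morphism[where s = s] up.star_wedge[where ?s1.0 = s1 and ?s2.0 = s2] assms)
      simp_all
qed

end
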